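(* Let $G$ be a finite group and let $R$ be an integral domain whose field of fractions has characteristic $0$. Assume that for every subgroup $U\le G$ and every prime divisor $p$ of $|\mathrm{Out}(U)|$ one has $pR\neq R$. Then $RB^{\lhd}(G,G)$ has no central idempotent different from $0$ and $1$. In particular, $0$ and $1$ are the only central idempotents of $B^{\lhd}(G,G)$.
   Context: A finite $(G,G)$-biset is a finite set with commuting left and right $G$-actions, identified with a left $G\times G$-set via $(g,h)x=gxh^{-1}$. $B(G,G)$ is the Grothendieck group of finite $(G,G)$-bisets w.r.t. disjoint union, a ring with multiplication induced by $X\times_G Y$ (the $G$-orbits of $X\times Y$ under $g(x,y)=(xg^{-1},gy)$). For $L\le G\times G$ let $k_1(L)=\{g\in G\mid (g,1)\in L\}$. The left-free double Burnside ring $B^{\lhd}(G,G)$ is the subring spanned by the classes of bisets all of whose point stabilizers $L$ satisfy $k_1(L)=1$, and $RB^{\lhd}(G,G)=R\otimes_{\mathbb{Z}}B^{\lhd}(G,G)$. *)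

theory Defs
  imports "HOL-Algebra.Algebra" "HOL-Computational_Algebra.Primes"
begin

definition inn :: "('a, 'b) monoid_scheme \<Rightarrow> ('a \<Rightarrow> 'a) set" where
  "inn H = {restrict (\<lambda>x. g \<otimes>\<^bsub>H\<^esub> x \<otimes>\<^bsub>H\<^esub> inv\<^bsub>H\<^esub> g) (carrier H) | g. g \<in> carrier H}"

definition out_order :: "('a, 'b) monoid_scheme \<Rightarrow> nat" where
  "out_order H = card (auto H) div card (inn H)"

definition left_cosets :: "('a, 'b) monoid_scheme \<Rightarrow> 'a set \<Rightarrow> 'a set set" where
  "left_cosets P L = {a <#\<^bsub>P\<^esub> L | a. a \<in> carrier P}"

definition conj_sub :: "('a, 'b) monoid_scheme \<Rightarrow> 'a \<Rightarrow> 'a set \<Rightarrow> 'a set" where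
  "conj_sub P x L = (\<lambda>l. x \<otimes>\<^bsub>P\<^esub> l \<otimes>\<^bsub>P\<^esub> inv\<^bsub>P\<^esub> x) ` L"

definition conj_class :: "('a, 'b) monoid_scheme \<Rightarrow> 'a set \<Rightarrow> 'a set set" where
  "conj_class P L = {conj_sub P x L | x. x \<in> carrier P}"

text \<open>Conjugacy classes of subgroups of G x G; they index the isomorphism classes
  of transitive (G,G)-bisets (L corresponds to (G x G)/L), i.e. the standard Z-basis of B(G,G).\<close>
definition sub_classes :: "('g, 'b) monoid_scheme \<Rightarrow> ('g \<times> 'g) set set set" where
  "sub_classes G = conj_class (G \<times>\<times> G) ` {L. subgroup L (G \<times>\<times> G)}"

definition rep :: "'a set set \<Rightarrow> 'a set" where
  "rep C = (SOME L. L \<in> C)"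

definition k1 :: "('g, 'b) monoid_scheme \<Rightarrow> ('g \<times> 'g) set \<Rightarrow> 'g set" where
  "k1 G L = {g \<in> carrier G. (g, \<one>\<^bsub>G\<^esub>) \<in> L}"

definition left_free :: "('g, 'b) monoid_scheme \<Rightarrow> ('g \<times> 'g) set \<Rightarrow> bool" where
  "left_free G L \<longleftrightarrow> k1 G L = {\<one>\<^bsub>G\<^esub>}"

definition diag :: "('g, 'b) monoid_scheme \<Rightarrow> ('g \<times> 'g) set" where
  "diag G = {(g, g) | g. g \<in> carrier G}"

text \<open>Here G x G acts on the left on X via (a,b)x = a x b^-1; so x g^-1 = (1,g)x and g y = (g,1)y.
  The G-orbits of X x Y under g(x,y) = (x g^-1, g y):\<close>
definition tens_rel :: "('g, 'b) monoid_scheme \<Rightarrow> ('g \<times> 'g) set \<Rightarrow> ('g \<times> 'g) set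
    \<Rightarrow> ((('g \<times> 'g) set \<times> ('g \<times> 'g) set) \<times> (('g \<times> 'g) set \<times> ('g \<times> 'g) set)) set" where
  "tens_rel G L M = {((x, y), (x', y')).
     (x, y) \<in> left_cosets (G \<times>\<times> G) L \<times> left_cosets (G \<times>\<times> G) M \<and>
     (x', y') \<in> left_cosets (G \<times>\<times> G) L \<times> left_cosets (G \<times>\<times> G) M \<and>
     (\<exists>g \<in> carrier G. x' = (\<one>\<^bsub>G\<^esub>, g) <#\<^bsub>G \<times>\<times> G\<^esub> x \<and> y' = (g, \<one>\<^bsub>G\<^esub>) <#\<^bsub>G \<times>\<times> G\<^esub> y)}"

definition tens :: "('g, 'b) monoid_scheme \<Rightarrow> ('g \<times> 'g) set \<Rightarrow> ('g \<times> 'g) set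
    \<Rightarrow> (('g \<times> 'g) set \<times> ('g \<times> 'g) set) set set" where
  "tens G L M = (left_cosets (G \<times>\<times> G) L \<times> left_cosets (G \<times>\<times> G) M) // tens_rel G L M"

text \<open>The (G,G)-biset structure on X x_G Y: a [x,y] b = [a x, y b], i.e. (a,b)[x,y] = [(a,1)x, (1,b)y].\<close>
definition tens_act :: "('g, 'b) monoid_scheme \<Rightarrow> 'g \<times> 'g
    \<Rightarrow> (('g \<times> 'g) set \<times> ('g \<times> 'g) set) set \<Rightarrow> (('g \<times> 'g) set \<times> ('g \<times> 'g) set) set" where
  "tens_act G s q = (\<lambda>(x, y). ((fst s, \<one>\<^bsub>G\<^esub>) <#\<^bsub>G \<times>\<times> G\<^esub> x, (\<one>\<^bsub>G\<^esub>, snd s) <#\<^bsub>G \<times>\<times> G\<^esub> y)) ` q"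

definition tens_stab :: "('g, 'b) monoid_scheme \<Rightarrow> (('g \<times> 'g) set \<times> ('g \<times> 'g) set) set \<Rightarrow> ('g \<times> 'g) set" where
  "tens_stab G q = {s \<in> carrier (G \<times>\<times> G). tens_act G s q = q}"

definition tens_orbit_rel :: "('g, 'b) monoid_scheme \<Rightarrow> ('g \<times> 'g) set \<Rightarrow> ('g \<times> 'g) set
    \<Rightarrow> ((('g \<times> 'g) set \<times> ('g \<times> 'g) set) set \<times> (('g \<times> 'g) set \<times> ('g \<times> 'g) set) set) set" where
  "tens_orbit_rel G L M = {(q, q'). q \<in> tens G L M \<and> q' \<in> tens G L M \<and>
      (\<exists>s \<in> carrier (G \<times>\<times> G). q' = tens_act G s q)}"

text \<open>Multiplicity of the transitive biset (G x G)/N in ((G x G)/L) x_G ((G x G)/M):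
  number of (G x G)-orbits whose point stabilizers are conjugate to N.\<close>
definition tens_coeff :: "('g, 'b) monoid_scheme \<Rightarrow> ('g \<times> 'g) set \<Rightarrow> ('g \<times> 'g) set \<Rightarrow> ('g \<times> 'g) set \<Rightarrow> nat" where
  "tens_coeff G L M N = card {Orb \<in> tens G L M // tens_orbit_rel G L M.
      \<exists>q \<in> Orb. tens_stab G q \<in> conj_class (G \<times>\<times> G) N}"

text \<open>An element of R B(G,G) is an R-valued function on the classes (coefficients w.r.t. the
  basis of transitive bisets), zero outside sub_classes G.\<close>
definition bs_mult :: "('g, 'b) monoid_scheme \<Rightarrow> (('g \<times> 'g) set set \<Rightarrow> 'r::comm_ring_1)
    \<Rightarrow> (('g \<times> 'g) set set \<Rightarrow> 'r) \<Rightarrow> (('g \<times> 'g) set set \<Rightarrow> 'r)" where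
  "bs_mult G f h = (\<lambda>C. if C \<in> sub_classes G then
      (\<Sum>A\<in>sub_classes G. \<Sum>B\<in>sub_classes G.
          f A * h B * of_nat (tens_coeff G (rep A) (rep B) (rep C)))
    else 0)"

definition bs_one :: "('g, 'b) monoid_scheme \<Rightarrow> (('g \<times> 'g) set set \<Rightarrow> 'r::comm_ring_1)" where
  "bs_one G = (\<lambda>C. if C = conj_class (G \<times>\<times> G) (diag G) then 1 else 0)"

definition RB_left_free :: "('g, 'b) monoid_scheme \<Rightarrow> (('g \<times> 'g) set set \<Rightarrow> 'r::comm_ring_1) set" where
  "RB_left_free G = {f. \<forall>C. f C \<noteq> 0 \<longrightarrow> C \<in> sub_classes G \<and> left_free G (rep C)}"

definition central_idempotent :: "('g, 'b) monoid_scheme \<Rightarrow> (('g \<times> 'g) set set \<Rightarrow> 'r::comm_ring_1) \<Rightarrow> bool" where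
  "central_idempotent G e \<longleftrightarrow> e \<in> RB_left_free G \<and> bs_mult G e e = e \<and>
     (\<forall>f \<in> RB_left_free G. bs_mult G e f = bs_mult G f e)"

end

(* A left-free biset is a sum of transitive bisets (G x G)/L, and its numbers of fixed points under the
   groups {(\<alpha> u, \<beta> u) | u : U}, for homomorphisms \<alpha>, \<beta> from a subgroup U to G, form a matrix indexed by
   Hom(U, G). Since G acts freely on left-free bisets, the product of bisets becomes, up to the factor |G|,
   the product of matrices. Let E be the matrix of a central idempotent e. Commuting with the indicator of
   the conjugacy class of the diagonal of U forces E to be block diagonal with respect to the set S of
   conjugates of automorphisms of U. All diagonal entries of the block S are equal, to |C(U)| x for some x
   in R; as E^2 = |G| E, its trace is |G| times its rank, so m x is an integer d between 0 and m for a
   divisor m of |Out(U)|. As no prime divisor of m is invertible, d is 0 or m, and e or 1 - e vanishes on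
   the block. Commuting with the indicator of the class of 1 x U compares this block with the one of the
   trivial group, so the same alternative holds for all U. *)

theory Submission
  imports Defs
begin

text \<open>Neither |G| nor |C(U)| need be invertible in R. Hence the matrices satisfy E^2 = |G| E
  instead of E^2 = E, and orders of groups are only cancelled from equations, which is legitimate in
  a domain of characteristic 0. The index set Hom(U, G) is redundant, since an entry depends on
  \<alpha> and \<beta> only up to conjugation in G. The redundancy is what makes the product of
  bisets an unweighted matrix product; its price is that the identity biset acts as the scalar |G|
  only on conjugation-invariant vectors.

  The bound d \<le> m needs no estimate of a rank: the argument for e applies verbatim to 1 - e and
  gives a natural number d', and the two traces add up to d + d' = m. The origin of m is |S| |C(U)|
  / |G| = |Aut(U)| |C(U)| / |N(U)|, which is |Out(U)| divided by the index of U C(U) in N(U).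

  The trivial group can serve as a common reference point because the mark of 1 there is |G|, which
  is not 0: e and 1 - e cannot both vanish at it, so one of the two alternatives is excluded for all
  U at once.\<close>

lemma card_fibres:
  assumes "finite A" "f ` A = B" "\<And>b. b \<in> B \<Longrightarrow> card {a \<in> A. f a = b} = n"
  shows "card A = n * card B"
proof -
  have "card A = (\<Sum>b\<in>B. card {a \<in> A. f a = b})"
    using sum.image_gen[OF assms(1), of "\<lambda>_. 1::nat" f] assms(2) by simp
  also have "\<dots> = n * card B" using assms(3) by simp
  finally show ?thesis .
qed

section \<open>Rank and trace over an integral domain\<close>

text \<open>The number d is the rank, realised as the size of a maximal independent set J of
  columns, so that no field of fractions is formed. If X consists of the columns in J, then C E = X
  B for some nonzero C, independence gives B X = C n I, and the trace of X B equals that of B X.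
  Rank 0 means that all columns vanish.\<close>

lemma trace_scaled_idempotent:
  fixes E :: "'s \<Rightarrow> 's \<Rightarrow> 'r::{idom, ring_char_0}"
  assumes fin: "finite S"
    and idem: "\<And>x y. x \<in> S \<Longrightarrow> y \<in> S \<Longrightarrow> (\<Sum>z\<in>S. E x z * E z y) = n * E x y"
  obtains d :: nat where "(\<Sum>x\<in>S. E x x) = n * of_nat d"
    and "d = 0 \<Longrightarrow> \<forall>x\<in>S. \<forall>y\<in>S. E x y = 0"
proof -
  define indep where "indep J \<longleftrightarrow> J \<subseteq> S \<and>
    (\<forall>c. (\<forall>x\<in>S. (\<Sum>j\<in>J. c j * E x j) = 0) \<longrightarrow> (\<forall>j\<in>J. c j = 0))" for J
  have "indep {}" by (simp add: indep_def)
  moreover have "card J \<le> card S" if "indep J" for J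
    using that fin by (auto simp: indep_def intro: card_mono)
  ultimately obtain J where J: "indep J" and Jmax: "\<And>K. indep K \<Longrightarrow> card K \<le> card J"
    using ex_has_greatest_nat[of indep "{}" card "Suc (card S)"] by (meson le_imp_less_Suc)
  have JS: "J \<subseteq> S" and finJ: "finite J"
    using J fin by (auto simp: indep_def intro: finite_subset)
  have J0: "\<forall>j\<in>J. c j = 0" if "\<And>x. x \<in> S \<Longrightarrow> (\<Sum>j\<in>J. c j * E x j) = 0" for c
    using J that unfolding indep_def by blast
  \<comment> \<open>By maximality of J every column depends on those in J; the coefficient c is the
    denominator that a field would divide by.\<close>
  have "\<exists>c b. c \<noteq> 0 \<and> (\<forall>x\<in>S. c * E x s = (\<Sum>j\<in>J. b j * E x j))" if s: "s \<in> S" for s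
  proof (cases "s \<in> J")
    case True
    have "1 * E x s = (\<Sum>j\<in>J. (if j = s then 1 else 0) * E x j)" for x
      using True finJ by (simp add: if_distrib[of "\<lambda>u. u * _"] cong: if_cong)
    then show ?thesis by (intro exI[of _ 1] exI[of _ "\<lambda>j. if j = s then 1 else 0"]) auto
  next
    case False
    then have "card (insert s J) > card J" using finJ by simp
    then have "\<not> indep (insert s J)" using Jmax by fastforce
    then obtain c where c: "\<forall>x\<in>S. (\<Sum>j\<in>insert s J. c j * E x j) = 0" and "\<exists>j\<in>insert s J. c j \<noteq> 0"
      using s JS unfolding indep_def by auto
    have eq: "c s * E x s + (\<Sum>j\<in>J. c j * E x j) = 0" if "x \<in> S" for x
      using c that False finJ by simp
    have "c s \<noteq> 0"
    proof
      assume "c s = 0"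
      with eq have "\<forall>j\<in>J. c j = 0" by (intro J0) simp
      with \<open>c s = 0\<close> \<open>\<exists>j\<in>insert s J. c j \<noteq> 0\<close> show False by auto
    qed
    moreover have "c s * E x s = (\<Sum>j\<in>J. - c j * E x j)" if "x \<in> S" for x
      using eq[OF that] by (simp add: sum_negf eq_neg_iff_add_eq_0)
    ultimately show ?thesis by (intro exI[of _ "c s"] exI[of _ "\<lambda>j. - c j"]) simp
  qed
  then obtain c b where c0: "\<And>s. s \<in> S \<Longrightarrow> c s \<noteq> 0"
    and b: "\<And>s x. s \<in> S \<Longrightarrow> x \<in> S \<Longrightarrow> c s * E x s = (\<Sum>j\<in>J. b s j * E x j)"
    by metis
  \<comment> \<open>A common denominator for all columns; the numerators \<open>B\<close> are
    rescaled to match it.\<close>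
  define C where "C = (\<Prod>s\<in>S. c s)"
  define B where "B s j = b s j * (\<Prod>t\<in>S-{s}. c t)" for s j
  have C0: "C \<noteq> 0" using c0 fin by (simp add: C_def)
  have B: "C * E x s = (\<Sum>j\<in>J. E x j * B s j)" if "x \<in> S" "s \<in> S" for x s
  proof -
    have "C * E x s = (c s * E x s) * (\<Prod>t\<in>S-{s}. c t)"
      unfolding C_def using that fin by (simp add: prod.remove[of S s])
    also have "\<dots> = (\<Sum>j\<in>J. E x j * B s j)"
      unfolding b[OF that(2,1)] B_def by (simp add: sum_distrib_left mult_ac)
    finally show ?thesis .
  qed
  define D where "D j i = (\<Sum>s\<in>S. B s j * E s i)" for j i
  \<comment> \<open>From X (B X) = C E X = C n X, the columns of B X - C n I are relations among the
    columns in J, hence zero.\<close>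
  have D: "D j i = (if j = i then C * n else 0)" if ij: "i \<in> J" "j \<in> J" for i j
  proof -
    have "(\<Sum>j\<in>J. (D j i - (if j = i then C * n else 0)) * E x j) = 0" if "x \<in> S" for x
    proof -
      have "(\<Sum>j\<in>J. D j i * E x j) = (\<Sum>j\<in>J. \<Sum>s\<in>S. E x j * B s j * E s i)"
        by (simp add: D_def sum_distrib_left mult_ac)
      also have "\<dots> = (\<Sum>s\<in>S. (\<Sum>j\<in>J. E x j * B s j) * E s i)"
        by (subst sum.swap) (simp add: sum_distrib_right)
      also have "\<dots> = (\<Sum>s\<in>S. C * (E x s * E s i))"
        using B[OF \<open>x \<in> S\<close>] by (auto intro!: sum.cong simp: mult_ac)
      also have "\<dots> = C * n * E x i"
        using idem[OF \<open>x \<in> S\<close>, of i] ij JS by (simp add: sum_distrib_left[symmetric] subset_iff mult_ac)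
      also have "\<dots> = (\<Sum>j\<in>J. (if j = i then C * n else 0) * E x j)"
        using ij finJ by (simp add: if_distrib[of "\<lambda>u. u * _"] cong: if_cong)
      finally show ?thesis by (simp add: left_diff_distrib sum_subtractf)
    qed
    from J0[OF this] ij show ?thesis by auto
  qed
  have "C * (\<Sum>x\<in>S. E x x) = (\<Sum>x\<in>S. \<Sum>j\<in>J. B x j * E x j)"
    unfolding sum_distrib_left by (rule sum.cong) (auto simp: B mult_ac)
  also have "\<dots> = (\<Sum>j\<in>J. D j j)" by (subst sum.swap) (simp add: D_def)
  also have "\<dots> = C * (n * of_nat (card J))" by (simp add: D)
  finally have "(\<Sum>x\<in>S. E x x) = n * of_nat (card J)" using C0 by simp
  moreover have "\<forall>x\<in>S. \<forall>y\<in>S. E x y = 0" if "card J = 0"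
    using that finJ B C0 by auto
  ultimately show thesis by (rule that)
qed

section \<open>Group actions and marks\<close>

text \<open>One locale serves four kinds of action: G \<times> G on cosets, G on pairs of cosets
  (its orbits are the points of the tensor product), G \<times> G on these points, and subgroups of
  G on homomorphisms by conjugation.\<close>

locale gset = group P for P :: "('p, 'c) monoid_scheme" (structure) +
  fixes \<Omega> :: "'x set" and act :: "'p \<Rightarrow> 'x \<Rightarrow> 'x"
  assumes act_closed: "s \<in> carrier P \<Longrightarrow> x \<in> \<Omega> \<Longrightarrow> act s x \<in> \<Omega>"
    and act_one: "x \<in> \<Omega> \<Longrightarrow> act \<one> x = x"
    and act_mult: "s \<in> carrier P \<Longrightarrow> t \<in> carrier P \<Longrightarrow> x \<in> \<Omega> \<Longrightarrow> act (s \<otimes> t) x = act s (act t x)"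
begin

definition orb :: "'x \<Rightarrow> 'x set" where "orb x = (\<lambda>s. act s x) ` carrier P"
definition stab :: "'x \<Rightarrow> 'p set" where "stab x = {s \<in> carrier P. act s x = x}"
definition orel :: "('x \<times> 'x) set" where
  "orel = {(x, y). x \<in> \<Omega> \<and> y \<in> \<Omega> \<and> (\<exists>s\<in>carrier P. y = act s x)}"
definition fixed :: "'p set \<Rightarrow> 'x set" where "fixed K = {x \<in> \<Omega>. \<forall>k\<in>K. act k x = x}"

lemma act_inv: "s \<in> carrier P \<Longrightarrow> x \<in> \<Omega> \<Longrightarrow> act (inv s) (act s x) = x"
  by (metis act_mult act_one inv_closed l_inv)

lemma act_inv': "s \<in> carrier P \<Longrightarrow> x \<in> \<Omega> \<Longrightarrow> act s (act (inv s) x) = x"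
  by (metis act_mult act_one inv_closed r_inv)

lemma act_eq_iff: "s \<in> carrier P \<Longrightarrow> x \<in> \<Omega> \<Longrightarrow> y \<in> \<Omega> \<Longrightarrow> act s x = act s y \<longleftrightarrow> x = y"
  by (metis act_inv)

lemma equiv_orel: "equiv \<Omega> orel"
proof (rule equivI)
  show "refl_on \<Omega> orel"
    unfolding refl_on_def orel_def using act_one one_closed by force
  show "sym orel"
  proof (rule symI)
    fix x y assume "(x, y) \<in> orel"
    then obtain s where "x \<in> \<Omega>" "y \<in> \<Omega>" "s \<in> carrier P" "y = act s x" by (auto simp: orel_def)
    then show "(y, x) \<in> orel"
      unfolding orel_def using act_inv by (auto intro!: bexI[of _ "inv s"])
  qed
  show "trans orel"
  proof (rule transI)
    fix x y z assume "(x, y) \<in> orel" "(y, z) \<in> orel"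
    then obtain s t where "x \<in> \<Omega>" "z \<in> \<Omega>" "s \<in> carrier P" "y = act s x" "t \<in> carrier P" "z = act t y"
      by (auto simp: orel_def)
    then show "(x, z) \<in> orel"
      unfolding orel_def by (auto intro!: bexI[of _ "t \<otimes> s"] simp: act_mult)
  qed
qed (auto simp: orel_def)

lemma orel_class: "x \<in> \<Omega> \<Longrightarrow> orel `` {x} = orb x"
  unfolding orel_def orb_def using act_closed by auto

lemma quotient_orel: "\<Omega> // orel = orb ` \<Omega>"
  unfolding quotient_def using orel_class by auto

lemma orb_eqI: "x \<in> \<Omega> \<Longrightarrow> s \<in> carrier P \<Longrightarrow> orb (act s x) = orb x"
  using equiv_class_eq[OF equiv_orel, of x "act s x"] act_closed orel_class
  by (fastforce simp: orel_def)

lemma orb_self: "x \<in> \<Omega> \<Longrightarrow> x \<in> orb x"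
  unfolding orb_def using act_one one_closed by force

lemma orb_eq_iff: "x \<in> \<Omega> \<Longrightarrow> y \<in> \<Omega> \<Longrightarrow> orb x = orb y \<longleftrightarrow> (\<exists>s\<in>carrier P. y = act s x)"
  using orb_self orb_eqI unfolding orb_def by (metis imageE)

lemma subgroup_stab: "x \<in> \<Omega> \<Longrightarrow> subgroup (stab x) P"
  unfolding stab_def
proof (rule subgroupI)
  assume x: "x \<in> \<Omega>"
  then show "{s \<in> carrier P. act s x = x} \<noteq> {}" using act_one one_closed by blast
  fix a assume a: "a \<in> {s \<in> carrier P. act s x = x}"
  then show "inv a \<in> {s \<in> carrier P. act s x = x}" using act_inv[of a x] x by simp
  fix b assume "b \<in> {s \<in> carrier P. act s x = x}"
  with a x show "a \<otimes> b \<in> {s \<in> carrier P. act s x = x}" by (simp add: act_mult)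
qed auto

lemma stab_act: "x \<in> \<Omega> \<Longrightarrow> s \<in> carrier P \<Longrightarrow> stab (act s x) = conj_sub P s (stab x)"
proof (intro equalityI subsetI)
  fix t assume x: "x \<in> \<Omega>" and s: "s \<in> carrier P" and t: "t \<in> stab (act s x)"
  then have tc: "t \<in> carrier P" and e: "act t (act s x) = act s x" by (auto simp: stab_def)
  have "act (inv s \<otimes> t \<otimes> s) x = x"
    using x s tc e by (simp add: act_mult act_closed act_inv)
  then have "inv s \<otimes> t \<otimes> s \<in> stab x" using s tc by (simp add: stab_def)
  moreover have "t = s \<otimes> (inv s \<otimes> t \<otimes> s) \<otimes> inv s"
    using s tc by (simp add: m_assoc) (simp add: m_assoc[symmetric])
  ultimately show "t \<in> conj_sub P s (stab x)" unfolding conj_sub_def by blast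
next
  fix t assume "x \<in> \<Omega>" "s \<in> carrier P" "t \<in> conj_sub P s (stab x)"
  then show "t \<in> stab (act s x)"
    by (auto simp: stab_def conj_sub_def act_mult act_closed act_inv)
qed

text \<open>The fibres of s -> s x are left cosets of the stabilizer. The case where F is the whole
  orbit is the orbit-stabilizer theorem; fixed points in an orbit are the other case of
  interest.\<close>

lemma card_act_into:
  assumes fin: "finite (carrier P)" and x: "x \<in> \<Omega>" and F: "F \<subseteq> orb x"
  shows "card {s \<in> carrier P. act s x \<in> F} = card (stab x) * card F"
proof (rule card_fibres[of _ "\<lambda>s. act s x"])
  show "(\<lambda>s. act s x) ` {s \<in> carrier P. act s x \<in> F} = F" using F by (auto simp: orb_def)
  fix y assume y: "y \<in> F"
  with F obtain s where s: "s \<in> carrier P" "y = act s x" by (auto simp: orb_def)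
  have "bij_betw (\<lambda>t. s \<otimes> t) (stab x) {a \<in> {s \<in> carrier P. act s x \<in> F}. act a x = y}"
    using s x y
    by (intro bij_betwI[where g = "\<lambda>t. inv s \<otimes> t"])
       (auto simp: stab_def act_mult act_inv m_assoc[symmetric])
  then show "card {a \<in> {s \<in> carrier P. act s x \<in> F}. act a x = y} = card (stab x)"
    by (rule bij_betw_same_card[symmetric])
qed (use fin in auto)

end

text \<open>For a subgroup N these are the s whose coset sN is fixed by K, equivalently those with K
  inside s N s^-1.\<close>

definition transporter :: "('p, 'c) monoid_scheme \<Rightarrow> 'p set \<Rightarrow> 'p set \<Rightarrow> 'p set" where
  "transporter P K N = {s \<in> carrier P. \<forall>k\<in>K. inv\<^bsub>P\<^esub> s \<otimes>\<^bsub>P\<^esub> k \<otimes>\<^bsub>P\<^esub> s \<in> N}"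

definition mark :: "('p, 'c) monoid_scheme \<Rightarrow> 'p set \<Rightarrow> 'p set \<Rightarrow> nat" where
  "mark P N K = card {x \<in> left_cosets P N. \<forall>k\<in>K. k <#\<^bsub>P\<^esub> x = x}"

lemma (in gset) card_fixed_orb:
  assumes fin: "finite (carrier P)" and x: "x \<in> \<Omega>" and K: "K \<subseteq> carrier P"
  shows "card (fixed K \<inter> orb x) * card (stab x) = card (transporter P K (stab x))"
proof -
  have "transporter P K (stab x) = {s \<in> carrier P. act s x \<in> fixed K \<inter> orb x}"
  proof -
    have "inv s \<otimes> k \<otimes> s \<in> stab x \<longleftrightarrow> act k (act s x) = act s x" if "s \<in> carrier P" "k \<in> K" for s k
    proof -
      have k: "k \<in> carrier P" using that K by auto
      have "inv s \<otimes> k \<otimes> s \<in> stab x \<longleftrightarrow> act (inv s) (act k (act s x)) = act (inv s) (act s x)"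
        using that x k by (simp add: stab_def act_mult act_closed act_inv)
      also have "\<dots> \<longleftrightarrow> act k (act s x) = act s x"
        using that x k by (intro act_eq_iff) (auto simp: act_closed)
      finally show ?thesis .
    qed
    then show ?thesis using x by (auto simp: transporter_def fixed_def orb_def act_closed)
  qed
  then show ?thesis using card_act_into[OF fin x, of "fixed K \<inter> orb x"] by simp
qed

lemma (in group) gset_left_cosets:
  assumes N: "subgroup N G"
  shows "gset G (left_cosets G N) (l_coset G)"
proof -
  have sub: "N \<subseteq> carrier G" using N by (rule subgroup.subset)
  show ?thesis
  proof unfold_locales
    fix s x assume "s \<in> carrier G" "x \<in> left_cosets G N"
    then show "s <# x \<in> left_cosets G N"
      unfolding left_cosets_def using lcos_m_assoc[OF sub] m_closed by blast
  next
    fix x assume "x \<in> left_cosets G N"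
    then show "\<one> <# x = x"
      unfolding left_cosets_def using lcos_mult_one l_coset_subset_G[OF sub] by blast
  next
    fix s t x assume "s \<in> carrier G" "t \<in> carrier G" "x \<in> left_cosets G N"
    then show "s \<otimes> t <# x = s <# (t <# x)"
      unfolding left_cosets_def using lcos_m_assoc l_coset_subset_G[OF sub] by auto
  qed
qed

context group
begin

text \<open>The coset N has stabilizer N and its orbit is everything, so a mark becomes a count of
  group elements. Conjugating N or K then merely translates the transporter.\<close>

lemma mark_transp:
  assumes fin: "finite (carrier G)" and N: "subgroup N G" and K: "K \<subseteq> carrier G"
  shows "mark G N K * card N = card (transporter G K N)"
proof -
  interpret c: gset G "left_cosets G N" "l_coset G" using N by (rule gset_left_cosets)
  have sub: "N \<subseteq> carrier G" using N by (rule subgroup.subset)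
  have NX: "N \<in> left_cosets G N" unfolding left_cosets_def
    using lcos_mult_one[OF sub] one_closed by force
  have "c.orb N = left_cosets G N" by (auto simp: c.orb_def left_cosets_def)
  moreover have "c.stab N = N"
  proof (intro equalityI subsetI)
    fix s assume "s \<in> c.stab N"
    then have "s \<in> carrier G" "s <# N = N" by (auto simp: c.stab_def)
    moreover from \<open>s \<in> carrier G\<close> have "s \<in> s <# N"
      using subgroup.one_closed[OF N] unfolding l_coset_def by force
    ultimately show "s \<in> N" by simp
  next
    fix s assume "s \<in> N"
    then show "s \<in> c.stab N" using sub coset_join3[OF _ N] by (auto simp: c.stab_def)
  qed
  moreover have "card (c.fixed K \<inter> left_cosets G N) = mark G N K"
    unfolding c.fixed_def mark_def by (auto intro: arg_cong[where f = card])
  ultimately show ?thesis using c.card_fixed_orb[OF fin NX K] by simp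
qed

end

section \<open>Conjugacy classes of subgroups and invariance of marks\<close>

context group
begin

lemma conj_sub_one: "L \<subseteq> carrier G \<Longrightarrow> conj_sub G \<one> L = L"
  unfolding conj_sub_def by force

lemma conj_sub_mult:
  assumes "x \<in> carrier G" "y \<in> carrier G" "L \<subseteq> carrier G"
  shows "conj_sub G (x \<otimes> y) L = conj_sub G x (conj_sub G y L)"
  unfolding conj_sub_def image_image
  using assms by (intro image_cong) (auto simp: inv_mult_group m_assoc subset_iff)

lemma conj_sub_subset: "x \<in> carrier G \<Longrightarrow> L \<subseteq> carrier G \<Longrightarrow> conj_sub G x L \<subseteq> carrier G"
  unfolding conj_sub_def by auto

lemma conj_sub_inv:
  assumes "x \<in> carrier G" "L \<subseteq> carrier G"
  shows "conj_sub G (inv x) (conj_sub G x L) = L" "conj_sub G x (conj_sub G (inv x) L) = L"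
  using assms conj_sub_mult[of "inv x" x L] conj_sub_mult[of x "inv x" L] conj_sub_one[of L]
  by simp_all

lemma subgroup_conj_sub:
  assumes x: "x \<in> carrier G" and L: "subgroup L G"
  shows "subgroup (conj_sub G x L) G"
proof (rule subgroupI)
  note sub = subgroup.subset[OF L]
  show "conj_sub G x L \<subseteq> carrier G" using x sub by (rule conj_sub_subset)
  show "conj_sub G x L \<noteq> {}" using subgroup.one_closed[OF L] by (auto simp: conj_sub_def)
  fix a assume "a \<in> conj_sub G x L"
  then obtain l where l: "l \<in> L" "a = x \<otimes> l \<otimes> inv x" by (auto simp: conj_sub_def)
  then have "inv a = x \<otimes> inv l \<otimes> inv x" using x sub by (auto simp: inv_mult_group m_assoc subset_iff)
  then show "inv a \<in> conj_sub G x L"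
    using subgroup.m_inv_closed[OF L l(1)] by (auto simp: conj_sub_def)
  fix b assume "b \<in> conj_sub G x L"
  then obtain m where m: "m \<in> L" "b = x \<otimes> m \<otimes> inv x" by (auto simp: conj_sub_def)
  have "inv x \<otimes> (x \<otimes> (m \<otimes> inv x)) = m \<otimes> inv x"
    using x m sub by (simp add: m_assoc[symmetric] subset_iff)
  then have "a \<otimes> b = x \<otimes> (l \<otimes> m) \<otimes> inv x" using l m x sub by (simp add: m_assoc subset_iff)
  then show "a \<otimes> b \<in> conj_sub G x L"
    using subgroup.m_closed[OF L l(1) m(1)] by (auto simp: conj_sub_def)
qed

lemma card_conj_sub:
  assumes "x \<in> carrier G" "L \<subseteq> carrier G"
  shows "card (conj_sub G x L) = card L"
  unfolding conj_sub_def using assms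
  by (intro card_image inj_onI) (simp add: subset_iff)

lemma conj_class_self: "L \<subseteq> carrier G \<Longrightarrow> L \<in> conj_class G L"
  using conj_sub_one[of L] one_closed unfolding conj_class_def by force

lemma conj_class_eq:
  assumes L: "L \<subseteq> carrier G" and M: "M \<in> conj_class G L"
  shows "conj_class G M = conj_class G L"
proof -
  from M obtain x where x: "x \<in> carrier G" "M = conj_sub G x L" by (auto simp: conj_class_def)
  show ?thesis
  proof (intro equalityI subsetI)
    fix N assume "N \<in> conj_class G M"
    then obtain y where "y \<in> carrier G" "N = conj_sub G y M" by (auto simp: conj_class_def)
    then have "N = conj_sub G (y \<otimes> x) L" using x conj_sub_mult L by simp
    then show "N \<in> conj_class G L" using \<open>y \<in> carrier G\<close> x by (auto simp: conj_class_def)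
  next
    fix N assume "N \<in> conj_class G L"
    then obtain y where y: "y \<in> carrier G" "N = conj_sub G y L" by (auto simp: conj_class_def)
    have "N = conj_sub G (y \<otimes> inv x) M"
      using x y L conj_sub_mult[of y "inv x" M] conj_sub_inv conj_sub_subset[OF x(1) L] by simp
    then show "N \<in> conj_class G M" using y x by (auto simp: conj_class_def)
  qed
qed

lemma conj_class_subgroup:
  "subgroup L G \<Longrightarrow> M \<in> conj_class G L \<Longrightarrow> subgroup M G"
  by (auto simp: conj_class_def subgroup_conj_sub)

lemma rep_in_conj_class:
  assumes "subgroup L G"
  shows "rep (conj_class G L) \<in> conj_class G L"
  unfolding rep_def using conj_class_self[OF subgroup.subset[OF assms]] by (rule someI)

lemma subgroup_rep: "subgroup L G \<Longrightarrow> subgroup (rep (conj_class G L)) G"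
  using rep_in_conj_class conj_class_subgroup by blast

lemma conj_class_rep: "subgroup L G \<Longrightarrow> conj_class G (rep (conj_class G L)) = conj_class G L"
  using rep_in_conj_class conj_class_eq subgroup.subset by blast

lemma conj_mem_iff:
  assumes "x \<in> carrier G" "y \<in> carrier G" "L \<subseteq> carrier G"
  shows "y \<in> conj_sub G x L \<longleftrightarrow> inv x \<otimes> y \<otimes> x \<in> L"
proof
  assume "y \<in> conj_sub G x L"
  then obtain l where l: "l \<in> L" "y = x \<otimes> l \<otimes> inv x" by (auto simp: conj_sub_def)
  then have "inv x \<otimes> y \<otimes> x = l"
    using assms by (simp add: m_assoc subset_iff) (simp add: m_assoc[symmetric] subset_iff)
  then show "inv x \<otimes> y \<otimes> x \<in> L" using l by simp
next
  assume "inv x \<otimes> y \<otimes> x \<in> L"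
  moreover have "y = x \<otimes> (inv x \<otimes> y \<otimes> x) \<otimes> inv x"
    using assms by (simp add: m_assoc) (simp add: m_assoc[symmetric])
  ultimately show "y \<in> conj_sub G x L" unfolding conj_sub_def by blast
qed

lemma transporter_iff:
  assumes "K \<subseteq> carrier G" "N \<subseteq> carrier G"
  shows "transporter G K N = {s \<in> carrier G. K \<subseteq> conj_sub G s N}"
  unfolding transporter_def using assms conj_mem_iff by blast

lemma card_transporter_conj:
  assumes fin: "finite (carrier G)" and x: "x \<in> carrier G"
    and K: "K \<subseteq> carrier G" and N: "N \<subseteq> carrier G"
  shows "card (transporter G K (conj_sub G x N)) = card (transporter G K N)"
    and "card (transporter G (conj_sub G x K) N) = card (transporter G K N)"
proof -
  have "bij_betw (\<lambda>s. s \<otimes> x) (transporter G K (conj_sub G x N)) (transporter G K N)"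
    using x K N conj_sub_subset[OF x N]
    by (intro bij_betwI[where g = "\<lambda>s. s \<otimes> inv x"])
       (auto simp: transporter_iff m_assoc conj_sub_mult conj_sub_inv)
  then show "card (transporter G K (conj_sub G x N)) = card (transporter G K N)"
    by (rule bij_betw_same_card)
  have *: "conj_sub G y A \<subseteq> conj_sub G y B" if "A \<subseteq> B" for y A B
    using that by (auto simp: conj_sub_def)
  have "bij_betw (\<lambda>s. x \<otimes> s) (transporter G K N) (transporter G (conj_sub G x K) N)"
  proof (intro bij_betwI[where g = "\<lambda>s. inv x \<otimes> s"])
    show "(\<lambda>s. x \<otimes> s) \<in> transporter G K N \<rightarrow> transporter G (conj_sub G x K) N"
      using x K N conj_sub_subset[OF x K] by (auto simp: transporter_iff conj_sub_mult dest!: *[of K _ x])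
    show "(\<lambda>s. inv x \<otimes> s) \<in> transporter G (conj_sub G x K) N \<rightarrow> transporter G K N"
      using x K N conj_sub_subset[OF x K]
      by (auto simp: transporter_iff conj_sub_mult conj_sub_inv dest!: *[of "conj_sub G x K" _ "inv x"])
  qed (use x in \<open>auto simp: transporter_def m_assoc[symmetric]\<close>)
  then show "card (transporter G (conj_sub G x K) N) = card (transporter G K N)"
    by (metis bij_betw_same_card)
qed

lemma mark_conj:
  assumes fin: "finite (carrier G)" and x: "x \<in> carrier G"
    and K: "K \<subseteq> carrier G" and N: "subgroup N G"
  shows "mark G (conj_sub G x N) K = mark G N K" and "mark G N (conj_sub G x K) = mark G N K"
proof -
  note sub = subgroup.subset[OF N]
  have pos: "card N \<noteq> 0"
    using fin sub subgroup.one_closed[OF N] by (auto simp: card_eq_0_iff dest: finite_subset)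
  show "mark G (conj_sub G x N) K = mark G N K"
    using mark_transp[OF fin N K] mark_transp[OF fin subgroup_conj_sub[OF x N] K]
      card_transporter_conj(1)[OF fin x K sub] card_conj_sub[OF x sub] pos by (metis mult_cancel2)
  show "mark G N (conj_sub G x K) = mark G N K"
    using mark_transp[OF fin N K] mark_transp[OF fin N conj_sub_subset[OF x K]]
      card_transporter_conj(2)[OF fin x K sub] pos by (metis mult_cancel2)
qed

lemma mark_conj_class:
  assumes "finite (carrier G)" "K \<subseteq> carrier G" "subgroup N G" "M \<in> conj_class G N"
  shows "mark G M K = mark G N K"
  using assms mark_conj(1) by (auto simp: conj_class_def)

lemma mark_self_nonzero:
  assumes fin: "finite (carrier G)" and N: "subgroup N G"
  shows "mark G N N \<noteq> 0"
proof -
  have "\<one> \<in> transporter G N N"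
    using subgroup.subset[OF N] by (auto simp: transporter_def subset_iff)
  moreover have "finite (transporter G N N)" using fin by (auto simp: transporter_def)
  ultimately have "card (transporter G N N) \<noteq> 0" by auto
  then show ?thesis using mark_transp[OF fin N subgroup.subset[OF N]] by (metis mult_0)
qed

lemma mark_nonzero_obtain:
  assumes "finite (carrier G)" "subgroup N G" "K \<subseteq> carrier G" "mark G N K \<noteq> 0"
  obtains x where "x \<in> carrier G" "K \<subseteq> conj_sub G x N"
proof -
  have "card N \<noteq> 0" using assms subgroup.one_closed[OF assms(2)] subgroup.subset[OF assms(2)]
    by (auto simp: card_eq_0_iff dest: finite_subset)
  then have "card (transporter G K N) \<noteq> 0"
    using mark_transp[OF assms(1,2,3)] assms(4) by (metis mult_is_0)
  then have "transporter G K N \<noteq> {}" by auto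
  then show thesis
    using that transporter_iff[OF assms(3) subgroup.subset[OF assms(2)]] by auto
qed

end

lemma (in gset) card_fixed_orb_mark:
  assumes fin: "finite (carrier P)" and x: "x \<in> \<Omega>" and K: "K \<subseteq> carrier P"
  shows "card (fixed K \<inter> orb x) = mark P (stab x) K"
proof -
  have "card (stab x) \<noteq> 0"
    using fin subgroup.one_closed[OF subgroup_stab[OF x]] subgroup.subset[OF subgroup_stab[OF x]]
    by (auto simp: card_eq_0_iff dest: finite_subset)
  moreover have "card (fixed K \<inter> orb x) * card (stab x) = mark P (stab x) K * card (stab x)"
    using card_fixed_orb[OF fin x K] mark_transp[OF fin subgroup_stab[OF x] K] by simp
  ultimately show ?thesis by simp
qed

text \<open>Fixed points are counted orbit by orbit, and an orbit with stabilizers in the class C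
  contributes the mark of \<open>rep C\<close>. The orbits are counted in the form used for the
  structure constants \<open>tens_coeff\<close>, so that these can be evaluated through fixed points
  alone.\<close>

lemma (in gset) card_fixed_eq_sum_classes:
  assumes fin: "finite (carrier P)" and fin\<Omega>: "finite \<Omega>" and K: "K \<subseteq> carrier P"
  shows "card (fixed K) = (\<Sum>C\<in>conj_class P ` {L. subgroup L P}.
    card {Or \<in> \<Omega> // orel. \<exists>q\<in>Or. stab q \<in> conj_class P (rep C)} * mark P (rep C) K)"
    (is "_ = (\<Sum>C\<in>?T. _)")
proof -
  \<comment> \<open>The type of an orbit. The chosen point does not matter, as stabilizers along an
    orbit are conjugate (\<open>g_eq\<close>).\<close>
  define g where "g Or = conj_class P (stab (SOME q. q \<in> Or))" for Or :: "'x set"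
  have finT: "finite ?T"
  proof (rule finite_imageI, rule finite_subset)
    show "{L. subgroup L P} \<subseteq> Pow (carrier P)" using subgroup.subset by blast
  qed (use fin in simp)
  have orbq: "q \<in> \<Omega> \<and> Or = orb q" if "Or \<in> \<Omega> // orel" "q \<in> Or" for Or q
    using that act_closed orb_eqI unfolding quotient_orel orb_def by blast
  have some: "(SOME q. q \<in> Or) \<in> Or" if "Or \<in> \<Omega> // orel" for Or
    using that orb_self unfolding quotient_orel by (metis imageE someI)
  have g_eq: "g Or = conj_class P (stab q)" if Or: "Or \<in> \<Omega> // orel" "q \<in> Or" for Or q
  proof -
    define r where "r = (SOME q. q \<in> Or)"
    have r: "r \<in> \<Omega>" "Or = orb r" using orbq[OF Or(1)] some[OF Or(1)] by (auto simp: r_def)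
    then obtain s where "s \<in> carrier P" "q = act s r" using Or(2) by (auto simp: orb_def)
    then have "stab q \<in> conj_class P (stab r)" using stab_act r by (auto simp: conj_class_def)
    then show ?thesis
      using conj_class_eq[OF subgroup.subset[OF subgroup_stab[OF r(1)]]] by (simp add: g_def r_def)
  qed
  have h: "card (fixed K \<inter> Or) = mark P (rep (g Or)) K" if Or: "Or \<in> \<Omega> // orel" for Or
  proof -
    define r where "r = (SOME q. q \<in> Or)"
    have r: "r \<in> \<Omega>" "Or = orb r" using orbq[OF Or] some[OF Or] by (auto simp: r_def)
    have "mark P (rep (g Or)) K = mark P (stab r) K"
      using mark_conj_class[OF fin K subgroup_stab[OF r(1)] rep_in_conj_class[OF subgroup_stab[OF r(1)]]]
      by (simp add: g_def r_def)
    then show ?thesis using card_fixed_orb_mark[OF fin r(1) K] r by simp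
  qed
  have gT: "g ` (\<Omega> // orel) \<subseteq> ?T"
    using orbq some subgroup_stab unfolding g_def by blast
  have "fixed K = (\<Union>Or\<in>\<Omega> // orel. fixed K \<inter> Or)"
    using Union_quotient[OF equiv_orel] by (auto simp: fixed_def)
  then have "card (fixed K) = card (\<Union>Or\<in>\<Omega> // orel. fixed K \<inter> Or)" by simp
  also have "\<dots> = (\<Sum>Or\<in>\<Omega> // orel. card (fixed K \<inter> Or))"
  proof (rule card_UN_disjoint)
    show "finite (\<Omega> // orel)" using fin\<Omega> by (simp add: quotient_orel)
    show "\<forall>Or\<in>\<Omega> // orel. finite (fixed K \<inter> Or)" using fin\<Omega> by (auto simp: fixed_def)
    show "\<forall>A\<in>\<Omega> // orel. \<forall>B\<in>\<Omega> // orel. A \<noteq> B \<longrightarrow> (fixed K \<inter> A) \<inter> (fixed K \<inter> B) = {}"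
      using quotient_disj[OF equiv_orel] by blast
  qed
  also have "\<dots> = (\<Sum>C\<in>?T. \<Sum>Or\<in>{Or \<in> \<Omega> // orel. g Or = C}. card (fixed K \<inter> Or))"
    using fin\<Omega> finT gT by (intro sum.group[symmetric]) (auto simp: quotient_orel)
  also have "\<dots> = (\<Sum>C\<in>?T. card {Or \<in> \<Omega> // orel. \<exists>q\<in>Or. stab q \<in> conj_class P (rep C)} * mark P (rep C) K)"
  proof (rule sum.cong[OF refl])
    fix C assume C: "C \<in> ?T"
    then obtain L where L: "subgroup L P" "C = conj_class P L" by auto
    have "{Or \<in> \<Omega> // orel. g Or = C} = {Or \<in> \<Omega> // orel. \<exists>q\<in>Or. stab q \<in> conj_class P (rep C)}"
    proof (intro Collect_cong conj_cong refl iffI)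
      fix Or assume Or: "Or \<in> \<Omega> // orel" "g Or = C"
      then have "stab (SOME q. q \<in> Or) \<in> conj_class P (rep C)"
        using orbq[OF Or(1)] some[OF Or(1)] conj_class_self subgroup.subset[OF subgroup_stab] L conj_class_rep
        by (metis g_def)
      then show "\<exists>q\<in>Or. stab q \<in> conj_class P (rep C)" using some[OF Or(1)] by blast
    next
      fix Or assume Or: "Or \<in> \<Omega> // orel" "\<exists>q\<in>Or. stab q \<in> conj_class P (rep C)"
      then show "g Or = C"
        using g_eq[OF Or(1)] L conj_class_rep conj_class_eq subgroup.subset subgroup_rep by metis
    qed
    moreover have "(\<Sum>Or\<in>{Or \<in> \<Omega> // orel. g Or = C}. card (fixed K \<inter> Or)) =
      (\<Sum>Or\<in>{Or \<in> \<Omega> // orel. g Or = C}. mark P (rep C) K)"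
      using h by (intro sum.cong) auto
    ultimately show "(\<Sum>Or\<in>{Or \<in> \<Omega> // orel. g Or = C}. card (fixed K \<inter> Or)) =
      card {Or \<in> \<Omega> // orel. \<exists>q\<in>Or. stab q \<in> conj_class P (rep C)} * mark P (rep C) K"
      by simp
  qed
  finally show ?thesis .
qed

section \<open>Fixed points of tensor products of bisets\<close>

text \<open>Extensionality outside U makes the set finite and lets a homomorphism be determined by
  its values on U, as an index of matrices must be.\<close>

definition homs :: "('g, 'b) monoid_scheme \<Rightarrow> 'g set \<Rightarrow> ('g \<Rightarrow> 'g) set" where
  "homs G U = {\<alpha> \<in> U \<rightarrow>\<^sub>E carrier G. \<forall>u\<in>U. \<forall>v\<in>U. \<alpha> (u \<otimes>\<^bsub>G\<^esub> v) = \<alpha> u \<otimes>\<^bsub>G\<^esub> \<alpha> v}"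

text \<open>A homomorphic image of U in G \<times> G, possibly smaller than U: injectivity is not
  imposed, because the homomorphisms summed over in a product are arbitrary.\<close>

definition pair_graph :: "'g set \<Rightarrow> ('g \<Rightarrow> 'g) \<Rightarrow> ('g \<Rightarrow> 'g) \<Rightarrow> ('g \<times> 'g) set" where
  "pair_graph U \<alpha> \<beta> = (\<lambda>u. (\<alpha> u, \<beta> u)) ` U"

locale fin_group = group G for G :: "('g, 'b) monoid_scheme" (structure) +
  assumes fin: "finite (carrier G)"
begin

sublocale P: group "G \<times>\<times> G"
  by (rule DirProd_group) (rule is_group)+

lemma finP: "finite (carrier (G \<times>\<times> G))"
  using fin by simp

lemma invP: "a \<in> carrier G \<Longrightarrow> b \<in> carrier G \<Longrightarrow> inv\<^bsub>G \<times>\<times> G\<^esub> (a, b) = (inv a, inv b)"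
  by (rule inv_DirProd[OF is_group is_group])

lemma inv_mult_eq_oneD: "inv a \<otimes> b = \<one> \<Longrightarrow> a \<in> carrier G \<Longrightarrow> b \<in> carrier G \<Longrightarrow> b = a"
  using inv_solve_left[of \<one> a b] by simp

lemma homs_closed: "\<alpha> \<in> homs G U \<Longrightarrow> u \<in> U \<Longrightarrow> \<alpha> u \<in> carrier G"
  by (auto simp: homs_def)

lemma homs_mult: "\<alpha> \<in> homs G U \<Longrightarrow> u \<in> U \<Longrightarrow> v \<in> U \<Longrightarrow> \<alpha> (u \<otimes> v) = \<alpha> u \<otimes> \<alpha> v"
  by (auto simp: homs_def)

lemma homs_ext: "\<alpha> \<in> homs G U \<Longrightarrow> \<beta> \<in> homs G U \<Longrightarrow> (\<And>u. u \<in> U \<Longrightarrow> \<alpha> u = \<beta> u) \<Longrightarrow> \<alpha> = \<beta>"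
  unfolding homs_def by (blast intro: PiE_ext)

lemma finite_homs: "subgroup U G \<Longrightarrow> finite (homs G U)"
  unfolding homs_def using fin finite_subset[OF subgroup.subset]
  by (intro finite_subset[OF Collect_restrict] finite_PiE) auto

lemma homs_one:
  assumes "subgroup U G" "\<alpha> \<in> homs G U"
  shows "\<alpha> \<one> = \<one>"
proof -
  note one = subgroup.one_closed[OF assms(1)]
  have "\<alpha> \<one> \<otimes> \<alpha> \<one> = \<alpha> \<one>" using homs_mult[OF assms(2) one one] by simp
  then show ?thesis using homs_closed[OF assms(2) one] by simp
qed

lemma homs_inv:
  assumes "subgroup U G" "\<alpha> \<in> homs G U" "u \<in> U"
  shows "\<alpha> (inv u) = inv (\<alpha> u)"
proof (rule inv_equality[symmetric])
  note iu = subgroup.m_inv_closed[OF assms(1,3)]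
  have "inv u \<otimes> u = \<one>" using subgroup.mem_carrier[OF assms(1,3)] by simp
  then show "\<alpha> (inv u) \<otimes> \<alpha> u = \<one>"
    using homs_mult[OF assms(2) iu assms(3)] homs_one[OF assms(1,2)] by simp
qed (use assms homs_closed[OF assms(2)] subgroup.m_inv_closed[OF assms(1,3)] in auto)

lemma pair_graph_subset: "\<alpha> \<in> homs G U \<Longrightarrow> \<beta> \<in> homs G U \<Longrightarrow> pair_graph U \<alpha> \<beta> \<subseteq> carrier (G \<times>\<times> G)"
  by (auto simp: pair_graph_def homs_closed)

lemma subgroup_pair_graph:
  assumes U: "subgroup U G" and "\<alpha> \<in> homs G U" "\<beta> \<in> homs G U"
  shows "subgroup (pair_graph U \<alpha> \<beta>) (G \<times>\<times> G)"
proof (rule P.subgroupI)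
  show "pair_graph U \<alpha> \<beta> \<noteq> {}" using subgroup.one_closed[OF U] by (auto simp: pair_graph_def)
  fix a assume "a \<in> pair_graph U \<alpha> \<beta>"
  then obtain u where u: "u \<in> U" "a = (\<alpha> u, \<beta> u)" by (auto simp: pair_graph_def)
  then have "inv\<^bsub>G \<times>\<times> G\<^esub> a = (\<alpha> (inv u), \<beta> (inv u))"
    using assms by (simp add: invP homs_inv homs_closed)
  then show "inv\<^bsub>G \<times>\<times> G\<^esub> a \<in> pair_graph U \<alpha> \<beta>"
    using subgroup.m_inv_closed[OF U u(1)] by (auto simp: pair_graph_def)
  fix b assume "b \<in> pair_graph U \<alpha> \<beta>"
  then obtain v where v: "v \<in> U" "b = (\<alpha> v, \<beta> v)" by (auto simp: pair_graph_def)
  then have "a \<otimes>\<^bsub>G \<times>\<times> G\<^esub> b = (\<alpha> (u \<otimes> v), \<beta> (u \<otimes> v))"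
    using u assms by (simp add: homs_mult)
  then show "a \<otimes>\<^bsub>G \<times>\<times> G\<^esub> b \<in> pair_graph U \<alpha> \<beta>"
    using subgroup.m_closed[OF U u(1) v(1)] by (auto simp: pair_graph_def)
qed (use pair_graph_subset[OF assms(2,3)] in auto)

end

section \<open>The tensor product of two transitive bisets\<close>

locale tensor = fin_group +
  fixes L M
  assumes L: "subgroup L (G \<times>\<times> G)" and M: "subgroup M (G \<times>\<times> G)"
begin

sublocale L: gset "G \<times>\<times> G" "left_cosets (G \<times>\<times> G) L" "l_coset (G \<times>\<times> G)"
  using L by (rule P.gset_left_cosets)

sublocale M: gset "G \<times>\<times> G" "left_cosets (G \<times>\<times> G) M" "l_coset (G \<times>\<times> G)"
  using M by (rule P.gset_left_cosets)

lemma L_act_mult: "a \<in> carrier G \<Longrightarrow> b \<in> carrier G \<Longrightarrow> c \<in> carrier G \<Longrightarrow> d \<in> carrier G \<Longrightarrow>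
  x \<in> left_cosets (G \<times>\<times> G) L \<Longrightarrow>
  (a, b) <#\<^bsub>G \<times>\<times> G\<^esub> ((c, d) <#\<^bsub>G \<times>\<times> G\<^esub> x) = (a \<otimes> c, b \<otimes> d) <#\<^bsub>G \<times>\<times> G\<^esub> x"
  using L.act_mult[of "(a, b)" "(c, d)" x] by simp

lemma M_act_mult: "a \<in> carrier G \<Longrightarrow> b \<in> carrier G \<Longrightarrow> c \<in> carrier G \<Longrightarrow> d \<in> carrier G \<Longrightarrow>
  x \<in> left_cosets (G \<times>\<times> G) M \<Longrightarrow>
  (a, b) <#\<^bsub>G \<times>\<times> G\<^esub> ((c, d) <#\<^bsub>G \<times>\<times> G\<^esub> x) = (a \<otimes> c, b \<otimes> d) <#\<^bsub>G \<times>\<times> G\<^esub> x"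
  using M.act_mult[of "(a, b)" "(c, d)" x] by simp

lemma L_act_closed: "a \<in> carrier G \<Longrightarrow> b \<in> carrier G \<Longrightarrow> x \<in> left_cosets (G \<times>\<times> G) L \<Longrightarrow>
  (a, b) <#\<^bsub>G \<times>\<times> G\<^esub> x \<in> left_cosets (G \<times>\<times> G) L"
  using L.act_closed[of "(a, b)" x] by simp

lemma M_act_closed: "a \<in> carrier G \<Longrightarrow> b \<in> carrier G \<Longrightarrow> x \<in> left_cosets (G \<times>\<times> G) M \<Longrightarrow>
  (a, b) <#\<^bsub>G \<times>\<times> G\<^esub> x \<in> left_cosets (G \<times>\<times> G) M"
  using M.act_closed[of "(a, b)" x] by simp

lemma L_act_one: "x \<in> left_cosets (G \<times>\<times> G) L \<Longrightarrow> (\<one>, \<one>) <#\<^bsub>G \<times>\<times> G\<^esub> x = x"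
  using L.act_one[of x] by simp

lemma M_act_one: "x \<in> left_cosets (G \<times>\<times> G) M \<Longrightarrow> (\<one>, \<one>) <#\<^bsub>G \<times>\<times> G\<^esub> x = x"
  using M.act_one[of x] by simp

lemmas acts = L_act_mult M_act_mult L_act_closed M_act_closed L_act_one M_act_one

sublocale T: gset G "left_cosets (G \<times>\<times> G) L \<times> left_cosets (G \<times>\<times> G) M"
  "\<lambda>g (x, y). ((\<one>, g) <#\<^bsub>G \<times>\<times> G\<^esub> x, (g, \<one>) <#\<^bsub>G \<times>\<times> G\<^esub> y)"
  by unfold_locales (auto simp: acts)

lemma tens_rel_eq: "tens_rel G L M = T.orel"
  by (auto simp: tens_rel_def T.orel_def)

lemma tens_eq: "tens G L M = T.orb ` (left_cosets (G \<times>\<times> G) L \<times> left_cosets (G \<times>\<times> G) M)"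
  by (simp add: tens_def tens_rel_eq T.quotient_orel)

lemma tens_act_orb:
  assumes "a \<in> carrier G" "b \<in> carrier G"
    and "x \<in> left_cosets (G \<times>\<times> G) L" "y \<in> left_cosets (G \<times>\<times> G) M"
  shows "tens_act G (a, b) (T.orb (x, y)) =
    T.orb ((a, \<one>) <#\<^bsub>G \<times>\<times> G\<^esub> x, (\<one>, b) <#\<^bsub>G \<times>\<times> G\<^esub> y)"
  unfolding tens_act_def T.orb_def image_image using assms
  by (intro image_cong) (auto simp: acts)

sublocale Q: gset "G \<times>\<times> G" "tens G L M" "tens_act G"
  by unfold_locales (auto simp: tens_eq tens_act_orb acts)

lemma tens_coeff_eq:
  "tens_coeff G L M N = card {Or \<in> tens G L M // Q.orel. \<exists>q\<in>Or. Q.stab q \<in> conj_class (G \<times>\<times> G) N}"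
  unfolding tens_coeff_def tens_stab_def Q.stab_def
  by (simp add: tens_orbit_rel_def Q.orel_def)

lemma finite_cosets:
  "finite (left_cosets (G \<times>\<times> G) L)" "finite (left_cosets (G \<times>\<times> G) M)"
  unfolding left_cosets_def Setcompr_eq_image using fin by auto

lemma sum_tens_coeff_mark:
  assumes "K \<subseteq> carrier (G \<times>\<times> G)"
  shows "(\<Sum>C\<in>sub_classes G. tens_coeff G L M (rep C) * mark (G \<times>\<times> G) (rep C) K) = card (Q.fixed K)"
proof -
  have "finite (tens G L M)" unfolding tens_eq using finite_cosets by blast
  from Q.card_fixed_eq_sum_classes[OF finP this assms] show ?thesis
    unfolding sub_classes_def tens_coeff_eq by (rule sym)
qed

text \<open>The stabilizer of (a, b)M is a conjugate of M. Translating y back to the base coset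
  turns g into a conjugate of g lying in \<open>k1 G M\<close>.\<close>

lemma M_free:
  assumes "left_free G M" "g \<in> carrier G" "y \<in> left_cosets (G \<times>\<times> G) M" "(g, \<one>) <#\<^bsub>G \<times>\<times> G\<^esub> y = y"
  shows "g = \<one>"
proof -
  obtain a b where ab: "a \<in> carrier G" "b \<in> carrier G" "y = (a, b) <#\<^bsub>G \<times>\<times> G\<^esub> M"
    using assms by (auto simp: left_cosets_def)
  have Mc: "M \<in> left_cosets (G \<times>\<times> G) M"
    unfolding left_cosets_def using P.lcos_mult_one[OF subgroup.subset[OF M]] P.one_closed by blast
  have "(inv a, inv b) <#\<^bsub>G \<times>\<times> G\<^esub> ((g, \<one>) <#\<^bsub>G \<times>\<times> G\<^esub> y) = (inv a, inv b) <#\<^bsub>G \<times>\<times> G\<^esub> y"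
    using assms(4) by simp
  then have "(inv a \<otimes> (g \<otimes> a), \<one>) <#\<^bsub>G \<times>\<times> G\<^esub> M = M"
    using ab assms Mc by (simp add: acts)
  moreover have "(inv a \<otimes> (g \<otimes> a), \<one>) \<in> (inv a \<otimes> (g \<otimes> a), \<one>) <#\<^bsub>G \<times>\<times> G\<^esub> M"
    unfolding l_coset_def using ab assms subgroup.one_closed[OF M] by force
  ultimately have "inv a \<otimes> (g \<otimes> a) \<in> k1 G M" using ab assms by (auto simp: k1_def)
  then have "inv a \<otimes> (g \<otimes> a) = \<one>" using assms(1) by (auto simp: left_free_def)
  then have "g \<otimes> a = a" using ab assms(2) inv_mult_eq_oneD by blast
  then show ?thesis using ab assms(2) by simp
qed

text \<open>Freeness in the form needed for products: a fixed point y lets b determine a. This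
  yields both the multiplicativity and the uniqueness of the homomorphism that links the two
  factors.\<close>

lemma M_free_unique:
  assumes "left_free G M" "a \<in> carrier G" "a' \<in> carrier G" "b \<in> carrier G" "y \<in> left_cosets (G \<times>\<times> G) M"
    and "(a, b) <#\<^bsub>G \<times>\<times> G\<^esub> y = y" "(a', b) <#\<^bsub>G \<times>\<times> G\<^esub> y = y"
  shows "a = a'"
proof -
  have "(inv a', inv b) <#\<^bsub>G \<times>\<times> G\<^esub> ((a, b) <#\<^bsub>G \<times>\<times> G\<^esub> y) =
      (inv a', inv b) <#\<^bsub>G \<times>\<times> G\<^esub> ((a', b) <#\<^bsub>G \<times>\<times> G\<^esub> y)"
    using assms by simp
  then have "(inv a' \<otimes> a, \<one>) <#\<^bsub>G \<times>\<times> G\<^esub> y = y" using assms(2-5) by (simp add: acts)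
  with assms have "inv a' \<otimes> a = \<one>" by (intro M_free[of "inv a' \<otimes> a" y]) auto
  then show ?thesis using assms(2,3) inv_mult_eq_oneD by blast
qed

text \<open>Double counting of the set W of pairs (x, y) whose class is fixed by all (\<alpha> u,
  \<beta> u). Over each fixed class lie |G| pairs, because G acts freely on them. On the other hand
  each such pair determines a unique \<delta> for which x is fixed by the (\<alpha> u, \<delta> u)
  and y by the (\<delta> u, \<beta> u).\<close>

theorem card_fixed_tens:
  assumes free: "left_free G M" and U: "subgroup U G"
    and \<alpha>: "\<alpha> \<in> homs G U" and \<beta>: "\<beta> \<in> homs G U"
  shows "card (carrier G) * card (Q.fixed (pair_graph U \<alpha> \<beta>)) =
    (\<Sum>\<delta>\<in>homs G U. mark (G \<times>\<times> G) L (pair_graph U \<alpha> \<delta>) * mark (G \<times>\<times> G) M (pair_graph U \<delta> \<beta>))"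
proof -
  let ?X = "left_cosets (G \<times>\<times> G) L" and ?Y = "left_cosets (G \<times>\<times> G) M"
  define W where "W = {w \<in> ?X \<times> ?Y. T.orb w \<in> Q.fixed (pair_graph U \<alpha> \<beta>)}"
  \<comment> \<open>The fibres are G-orbits of pairs; the action is free already on the second
    coordinate.\<close>
  have "card W = card (carrier G) * card (Q.fixed (pair_graph U \<alpha> \<beta>))"
  proof (rule card_fibres[of _ T.orb])
    show "finite W" using finite_cosets by (auto simp: W_def)
    have "Q.fixed (pair_graph U \<alpha> \<beta>) \<subseteq> T.orb ` (?X \<times> ?Y)"
      unfolding Q.fixed_def by (subst tens_eq[symmetric]) blast
    then show "T.orb ` W = Q.fixed (pair_graph U \<alpha> \<beta>)" unfolding W_def by blast
    fix q assume "q \<in> Q.fixed (pair_graph U \<alpha> \<beta>)"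
    moreover from this have "q \<in> tens G L M" by (simp add: Q.fixed_def)
    ultimately obtain x y where xy: "x \<in> ?X" "y \<in> ?Y" "q = T.orb (x, y)" "T.orb (x, y) \<in> Q.fixed (pair_graph U \<alpha> \<beta>)"
      unfolding tens_eq by blast
    have "inj_on (\<lambda>g. ((\<one>, g) <#\<^bsub>G \<times>\<times> G\<^esub> x, (g, \<one>) <#\<^bsub>G \<times>\<times> G\<^esub> y)) (carrier G)"
    proof (rule inj_onI)
      fix g h assume gh: "g \<in> carrier G" "h \<in> carrier G"
        "((\<one>, g) <#\<^bsub>G \<times>\<times> G\<^esub> x, (g, \<one>) <#\<^bsub>G \<times>\<times> G\<^esub> y) = ((\<one>, h) <#\<^bsub>G \<times>\<times> G\<^esub> x, (h, \<one>) <#\<^bsub>G \<times>\<times> G\<^esub> y)"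
      then have "(inv h, \<one>) <#\<^bsub>G \<times>\<times> G\<^esub> ((g, \<one>) <#\<^bsub>G \<times>\<times> G\<^esub> y) = (inv h, \<one>) <#\<^bsub>G \<times>\<times> G\<^esub> ((h, \<one>) <#\<^bsub>G \<times>\<times> G\<^esub> y)"
        by simp
      then have "(inv h \<otimes> g, \<one>) <#\<^bsub>G \<times>\<times> G\<^esub> y = y" using gh xy by (simp add: acts)
      with gh xy free have "inv h \<otimes> g = \<one>" by (intro M_free[of "inv h \<otimes> g" y]) auto
      then show "g = h" using gh(1,2) inv_mult_eq_oneD by blast
    qed
    then have "card (T.orb (x, y)) = card (carrier G)"
      unfolding T.orb_def by (simp add: card_image)
    moreover have "{w \<in> W. T.orb w = q} = T.orb (x, y)"
    proof (intro equalityI subsetI)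
      fix w assume "w \<in> {w \<in> W. T.orb w = q}"
      then show "w \<in> T.orb (x, y)" using xy T.orb_self by (auto simp: W_def)
    next
      fix w assume "w \<in> T.orb (x, y)"
      then obtain g where g: "g \<in> carrier G" "w = (\<lambda>(x, y). ((\<one>, g) <#\<^bsub>G \<times>\<times> G\<^esub> x, (g, \<one>) <#\<^bsub>G \<times>\<times> G\<^esub> y)) (x, y)"
        by (auto simp: T.orb_def)
      then have "w \<in> ?X \<times> ?Y" "T.orb w = T.orb (x, y)"
        using xy T.act_closed[of g "(x, y)"] T.orb_eqI[of "(x, y)" g] by auto
      then show "w \<in> {w \<in> W. T.orb w = q}" using xy by (auto simp: W_def)
    qed
    ultimately show "card {w \<in> W. T.orb w = q} = card (carrier G)" by simp
  qed
  moreover have "W = (\<Union>\<delta>\<in>homs G U. L.fixed (pair_graph U \<alpha> \<delta>) \<times> M.fixed (pair_graph U \<delta> \<beta>))"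
  proof (intro equalityI subsetI)
    fix w assume "w \<in> W"
    then obtain x y where xy: "w = (x, y)" "x \<in> ?X" "y \<in> ?Y" "T.orb (x, y) \<in> Q.fixed (pair_graph U \<alpha> \<beta>)"
      by (auto simp: W_def)
    \<comment> \<open>The class of (x, y) being fixed by (\<alpha> u, \<beta> u) means that the
      moved pair lies in the same G-orbit, so some g carries (x, y) to it.\<close>
    have "\<exists>g\<in>carrier G. (\<alpha> u, \<one>) <#\<^bsub>G \<times>\<times> G\<^esub> x = (\<one>, g) <#\<^bsub>G \<times>\<times> G\<^esub> x \<and>
        (\<one>, \<beta> u) <#\<^bsub>G \<times>\<times> G\<^esub> y = (g, \<one>) <#\<^bsub>G \<times>\<times> G\<^esub> y" if u: "u \<in> U" for u
    proof -
      have "tens_act G (\<alpha> u, \<beta> u) (T.orb (x, y)) = T.orb (x, y)"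
        using xy u by (auto simp: Q.fixed_def pair_graph_def)
      then have "T.orb (x, y) = T.orb ((\<alpha> u, \<one>) <#\<^bsub>G \<times>\<times> G\<^esub> x, (\<one>, \<beta> u) <#\<^bsub>G \<times>\<times> G\<^esub> y)"
        using xy u \<alpha> \<beta> by (simp add: tens_act_orb homs_closed)
      then show ?thesis
        using xy u \<alpha> \<beta> by (subst (asm) T.orb_eq_iff) (auto simp: homs_closed acts)
    qed
    then obtain g where g: "\<And>u. u \<in> U \<Longrightarrow> g u \<in> carrier G"
      "\<And>u. u \<in> U \<Longrightarrow> (\<alpha> u, \<one>) <#\<^bsub>G \<times>\<times> G\<^esub> x = (\<one>, g u) <#\<^bsub>G \<times>\<times> G\<^esub> x"
      "\<And>u. u \<in> U \<Longrightarrow> (\<one>, \<beta> u) <#\<^bsub>G \<times>\<times> G\<^esub> y = (g u, \<one>) <#\<^bsub>G \<times>\<times> G\<^esub> y"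
      by metis
    \<comment> \<open>The inverse appears because cancelling (1, g) on x and (g, 1) on y leaves
      (\<alpha> u, g^-1) fixing x and (g^-1, \<beta> u) fixing y.\<close>
    define \<delta> where "\<delta> = (\<lambda>u\<in>U. inv (g u))"
    have \<delta>c: "\<delta> u \<in> carrier G" if "u \<in> U" for u using that g by (simp add: \<delta>_def)
    have \<delta>x: "(\<alpha> u, \<delta> u) <#\<^bsub>G \<times>\<times> G\<^esub> x = x" if u: "u \<in> U" for u
    proof -
      have "(\<one>, inv (g u)) <#\<^bsub>G \<times>\<times> G\<^esub> ((\<alpha> u, \<one>) <#\<^bsub>G \<times>\<times> G\<^esub> x) =
          (\<one>, inv (g u)) <#\<^bsub>G \<times>\<times> G\<^esub> ((\<one>, g u) <#\<^bsub>G \<times>\<times> G\<^esub> x)"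
        using g(2)[OF u] by simp
      then show ?thesis using xy u g(1)[OF u] homs_closed[OF \<alpha> u] by (simp add: acts \<delta>_def)
    qed
    have \<delta>y: "(\<delta> u, \<beta> u) <#\<^bsub>G \<times>\<times> G\<^esub> y = y" if u: "u \<in> U" for u
    proof -
      have "(inv (g u), \<one>) <#\<^bsub>G \<times>\<times> G\<^esub> ((\<one>, \<beta> u) <#\<^bsub>G \<times>\<times> G\<^esub> y) =
          (inv (g u), \<one>) <#\<^bsub>G \<times>\<times> G\<^esub> ((g u, \<one>) <#\<^bsub>G \<times>\<times> G\<^esub> y)"
        using g(3)[OF u] by simp
      then show ?thesis using xy u g(1)[OF u] homs_closed[OF \<beta> u] by (simp add: acts \<delta>_def)
    qed
    have "\<delta> \<in> homs G U"
      unfolding homs_def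
    proof (intro CollectI conjI ballI)
      show "\<delta> \<in> U \<rightarrow>\<^sub>E carrier G" using \<delta>c by (auto simp: \<delta>_def)
      fix u v assume uv: "u \<in> U" "v \<in> U"
      then have "u \<otimes> v \<in> U" by (rule subgroup.m_closed[OF U])
      \<comment> \<open>Both \<delta> (u v) and \<delta> u \<delta> v, paired with \<beta> (u v),
        fix y; uniqueness of the first component makes them equal.\<close>
      moreover have "(\<delta> u \<otimes> \<delta> v, \<beta> (u \<otimes> v)) <#\<^bsub>G \<times>\<times> G\<^esub> y = y"
      proof -
        have "(\<delta> u, \<beta> u) <#\<^bsub>G \<times>\<times> G\<^esub> ((\<delta> v, \<beta> v) <#\<^bsub>G \<times>\<times> G\<^esub> y) = y"
          using \<delta>y uv by simp
        then show ?thesis using uv xy \<delta>c homs_closed[OF \<beta>] homs_mult[OF \<beta>] by (simp add: acts)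
      qed
      ultimately show "\<delta> (u \<otimes> v) = \<delta> u \<otimes> \<delta> v"
        using uv xy \<delta>y \<delta>c homs_closed[OF \<beta>] free
        by (intro M_free_unique[of _ _ "\<beta> (u \<otimes> v)" y]) auto
    qed
    moreover have "w \<in> L.fixed (pair_graph U \<alpha> \<delta>) \<times> M.fixed (pair_graph U \<delta> \<beta>)"
      using xy \<delta>x \<delta>y by (auto simp: L.fixed_def M.fixed_def pair_graph_def)
    ultimately show "w \<in> (\<Union>\<delta>\<in>homs G U. L.fixed (pair_graph U \<alpha> \<delta>) \<times> M.fixed (pair_graph U \<delta> \<beta>))" by blast
  next
    fix w assume "w \<in> (\<Union>\<delta>\<in>homs G U. L.fixed (pair_graph U \<alpha> \<delta>) \<times> M.fixed (pair_graph U \<delta> \<beta>))"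
    then obtain \<delta> x y where \<delta>: "\<delta> \<in> homs G U" and w: "w = (x, y)" "x \<in> ?X" "y \<in> ?Y"
      and fx: "\<And>u. u \<in> U \<Longrightarrow> (\<alpha> u, \<delta> u) <#\<^bsub>G \<times>\<times> G\<^esub> x = x"
      and fy: "\<And>u. u \<in> U \<Longrightarrow> (\<delta> u, \<beta> u) <#\<^bsub>G \<times>\<times> G\<^esub> y = y"
      by (auto simp: L.fixed_def M.fixed_def pair_graph_def)
    have "tens_act G (\<alpha> u, \<beta> u) (T.orb (x, y)) = T.orb (x, y)" if u: "u \<in> U" for u
    proof -
      note c = homs_closed[OF \<alpha> u] homs_closed[OF \<beta> u] homs_closed[OF \<delta> u]
      have "(\<one>, inv (\<delta> u)) <#\<^bsub>G \<times>\<times> G\<^esub> ((\<alpha> u, \<delta> u) <#\<^bsub>G \<times>\<times> G\<^esub> x) = (\<alpha> u, \<one>) <#\<^bsub>G \<times>\<times> G\<^esub> x"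
        "(inv (\<delta> u), \<one>) <#\<^bsub>G \<times>\<times> G\<^esub> ((\<delta> u, \<beta> u) <#\<^bsub>G \<times>\<times> G\<^esub> y) = (\<one>, \<beta> u) <#\<^bsub>G \<times>\<times> G\<^esub> y"
        using c w by (simp_all add: acts)
      then have "(\<alpha> u, \<one>) <#\<^bsub>G \<times>\<times> G\<^esub> x = (\<one>, inv (\<delta> u)) <#\<^bsub>G \<times>\<times> G\<^esub> x"
        "(\<one>, \<beta> u) <#\<^bsub>G \<times>\<times> G\<^esub> y = (inv (\<delta> u), \<one>) <#\<^bsub>G \<times>\<times> G\<^esub> y"
        using fx[OF u] fy[OF u] by simp_all
      then show ?thesis
        using T.orb_eqI[of "(x, y)" "inv (\<delta> u)"] c w by (simp add: tens_act_orb)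
    qed
    moreover have "T.orb (x, y) \<in> tens G L M" using w unfolding tens_eq by blast
    ultimately show "w \<in> W" using w by (auto simp: W_def Q.fixed_def pair_graph_def)
  qed
  moreover have "card (\<Union>\<delta>\<in>homs G U. L.fixed (pair_graph U \<alpha> \<delta>) \<times> M.fixed (pair_graph U \<delta> \<beta>)) =
      (\<Sum>\<delta>\<in>homs G U. card (L.fixed (pair_graph U \<alpha> \<delta>) \<times> M.fixed (pair_graph U \<delta> \<beta>)))"
  proof (rule card_UN_disjoint)
    show "finite (homs G U)" using finite_homs[OF U] .
    show "\<forall>\<delta>\<in>homs G U. finite (L.fixed (pair_graph U \<alpha> \<delta>) \<times> M.fixed (pair_graph U \<delta> \<beta>))"
      using finite_cosets by (auto simp: L.fixed_def M.fixed_def)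
    have "\<delta> = \<epsilon>" if "\<delta> \<in> homs G U" "\<epsilon> \<in> homs G U" "y \<in> M.fixed (pair_graph U \<delta> \<beta>)" "y \<in> M.fixed (pair_graph U \<epsilon> \<beta>)" for \<delta> \<epsilon> y
    proof (rule homs_ext[OF that(1,2)])
      fix u assume "u \<in> U"
      then show "\<delta> u = \<epsilon> u" using that free \<beta>
        by (intro M_free_unique[of _ _ "\<beta> u" y]) (auto simp: M.fixed_def pair_graph_def homs_closed)
    qed
    then show "\<forall>\<delta>\<in>homs G U. \<forall>\<epsilon>\<in>homs G U. \<delta> \<noteq> \<epsilon> \<longrightarrow>
       (L.fixed (pair_graph U \<alpha> \<delta>) \<times> M.fixed (pair_graph U \<delta> \<beta>)) \<inter> (L.fixed (pair_graph U \<alpha> \<epsilon>) \<times> M.fixed (pair_graph U \<epsilon> \<beta>)) = {}"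
      by blast
  qed
  ultimately show ?thesis
    by (simp add: card_cartesian_product L.fixed_def M.fixed_def mark_def)
qed

end

section \<open>The mark homomorphism\<close>

text \<open>The R-linear extension of counting K-fixed points: the ghost coordinates of f.\<close>

definition marks :: "('g, 'b) monoid_scheme \<Rightarrow> (('g \<times> 'g) set set \<Rightarrow> 'r::comm_ring_1) \<Rightarrow> ('g \<times> 'g) set \<Rightarrow> 'r" where
  "marks G f K = (\<Sum>A\<in>sub_classes G. f A * of_nat (mark (G \<times>\<times> G) (rep A) K))"

text \<open>The (\<alpha>, \<beta>) entry of the product of the Hom(U, G)-matrices of E and
  F.\<close>

definition mark_conv :: "('g, 'b) monoid_scheme \<Rightarrow> 'g set \<Rightarrow> (('g \<times> 'g) set \<Rightarrow> 'r::comm_ring_1) \<Rightarrow>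
    (('g \<times> 'g) set \<Rightarrow> 'r) \<Rightarrow> ('g \<Rightarrow> 'g) \<Rightarrow> ('g \<Rightarrow> 'g) \<Rightarrow> 'r" where
  "mark_conv G U E F \<alpha> \<beta> = (\<Sum>\<delta>\<in>homs G U. E (pair_graph U \<alpha> \<delta>) * F (pair_graph U \<delta> \<beta>))"

definition class_ind :: "('g, 'b) monoid_scheme \<Rightarrow> ('g \<times> 'g) set \<Rightarrow> ('g \<times> 'g) set \<Rightarrow> 'r::comm_ring_1" where
  "class_ind G L K = of_bool (K \<in> conj_class (G \<times>\<times> G) L)"

definition class_fun :: "('g, 'b) monoid_scheme \<Rightarrow> (('g \<times> 'g) set \<Rightarrow> 'r) \<Rightarrow> bool" where
  "class_fun G F \<longleftrightarrow> (\<forall>K x. subgroup K (G \<times>\<times> G) \<longrightarrow> x \<in> carrier (G \<times>\<times> G) \<longrightarrow>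
     F (conj_sub (G \<times>\<times> G) x K) = F K)"

definition conjh :: "('g, 'b) monoid_scheme \<Rightarrow> 'g set \<Rightarrow> 'g \<Rightarrow> ('g \<Rightarrow> 'g) \<Rightarrow> 'g \<Rightarrow> 'g" where
  "conjh G U g \<alpha> = (\<lambda>u\<in>U. g \<otimes>\<^bsub>G\<^esub> \<alpha> u \<otimes>\<^bsub>G\<^esub> inv\<^bsub>G\<^esub> g)"

context fin_group
begin

lemma finite_sub_classes: "finite (sub_classes G)"
proof -
  have "{L. subgroup L (G \<times>\<times> G)} \<subseteq> Pow (carrier (G \<times>\<times> G))" using subgroup.subset by blast
  then have "finite {L. subgroup L (G \<times>\<times> G)}" using finP finite_subset by blast
  then show ?thesis by (simp add: sub_classes_def)
qed

lemma sub_classes_rep: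
  assumes "C \<in> sub_classes G"
  shows "subgroup (rep C) (G \<times>\<times> G)" "conj_class (G \<times>\<times> G) (rep C) = C" "rep C \<in> C"
  using assms P.subgroup_rep P.conj_class_rep P.rep_in_conj_class by (auto simp: sub_classes_def)

lemma conj_class_in_sub_classes: "subgroup L (G \<times>\<times> G) \<Longrightarrow> conj_class (G \<times>\<times> G) L \<in> sub_classes G"
  by (simp add: sub_classes_def)

text \<open>The bilinear extension of \<open>card_fixed_tens\<close>. Freeness was used for the
  right-hand factor alone, so the condition is on h.\<close>

lemma marks_bs_mult:
  assumes h: "h \<in> RB_left_free G" and U: "subgroup U G"
    and \<alpha>: "\<alpha> \<in> homs G U" and \<beta>: "\<beta> \<in> homs G U"
  shows "of_nat (card (carrier G)) * marks G (bs_mult G f h) (pair_graph U \<alpha> \<beta>) = mark_conv G U (marks G f) (marks G h) \<alpha> \<beta>"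
proof -
  let ?S = "sub_classes G" and ?m = "mark (G \<times>\<times> G)" and ?K = "pair_graph U \<alpha> \<beta>" and ?n = "card (carrier G)"
  have K: "?K \<subseteq> carrier (G \<times>\<times> G)" using \<alpha> \<beta> by (rule pair_graph_subset)
  define c where "c A B = (\<Sum>C\<in>?S. tens_coeff G (rep A) (rep B) (rep C) * ?m (rep C) ?K)" for A B
  define d where "d A B = (\<Sum>\<delta>\<in>homs G U. ?m (rep A) (pair_graph U \<alpha> \<delta>) * ?m (rep B) (pair_graph U \<delta> \<beta>))" for A B
  \<comment> \<open>The factor h B is kept on both sides: it is 0 on classes that are not left-free,
    where the counting formula is not at hand.\<close>
  have cd: "h B * of_nat (?n * c A B) = h B * of_nat (d A B)" if A: "A \<in> ?S" and B: "B \<in> ?S" for A B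
  proof (cases "h B = 0")
    case False
    then have "left_free G (rep B)" using h by (auto simp: RB_left_free_def)
    interpret t: tensor G "rep A" "rep B"
      by (intro tensor.intro tensor_axioms.intro fin_group_axioms sub_classes_rep(1) A B)
    have "?n * c A B = d A B"
      unfolding c_def d_def t.sum_tens_coeff_mark[OF K]
      by (rule t.card_fixed_tens[OF \<open>left_free G (rep B)\<close> U \<alpha> \<beta>])
    then show ?thesis by simp
  qed simp
  have "marks G (bs_mult G f h) ?K =
      (\<Sum>C\<in>?S. \<Sum>A\<in>?S. \<Sum>B\<in>?S. f A * (h B * of_nat (tens_coeff G (rep A) (rep B) (rep C) * ?m (rep C) ?K)))"
    by (simp add: marks_def bs_mult_def sum_distrib_right mult.assoc)
  also have "\<dots> = (\<Sum>A\<in>?S. \<Sum>C\<in>?S. \<Sum>B\<in>?S. f A * (h B * of_nat (tens_coeff G (rep A) (rep B) (rep C) * ?m (rep C) ?K)))"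
    by (rule sum.swap)
  also have "\<dots> = (\<Sum>A\<in>?S. \<Sum>B\<in>?S. \<Sum>C\<in>?S. f A * (h B * of_nat (tens_coeff G (rep A) (rep B) (rep C) * ?m (rep C) ?K)))"
    by (intro sum.cong refl sum.swap)
  also have "\<dots> = (\<Sum>A\<in>?S. \<Sum>B\<in>?S. f A * (h B * of_nat (c A B)))"
    by (simp only: c_def sum_distrib_left of_nat_sum)
  finally have "of_nat ?n * marks G (bs_mult G f h) ?K = (\<Sum>A\<in>?S. \<Sum>B\<in>?S. f A * (h B * of_nat (?n * c A B)))"
    by (simp add: sum_distrib_left mult_ac)
  also have "\<dots> = (\<Sum>A\<in>?S. \<Sum>B\<in>?S. f A * (h B * of_nat (d A B)))"
    using cd by (intro sum.cong refl) simp
  also have "\<dots> = (\<Sum>A\<in>?S. \<Sum>B\<in>?S. \<Sum>\<delta>\<in>homs G U.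
      (f A * of_nat (?m (rep A) (pair_graph U \<alpha> \<delta>))) * (h B * of_nat (?m (rep B) (pair_graph U \<delta> \<beta>))))"
    by (simp add: d_def sum_distrib_left mult_ac)
  also have "\<dots> = (\<Sum>A\<in>?S. \<Sum>\<delta>\<in>homs G U. \<Sum>B\<in>?S.
      (f A * of_nat (?m (rep A) (pair_graph U \<alpha> \<delta>))) * (h B * of_nat (?m (rep B) (pair_graph U \<delta> \<beta>))))"
    by (intro sum.cong refl sum.swap)
  also have "\<dots> = (\<Sum>\<delta>\<in>homs G U. \<Sum>A\<in>?S. \<Sum>B\<in>?S.
      (f A * of_nat (?m (rep A) (pair_graph U \<alpha> \<delta>))) * (h B * of_nat (?m (rep B) (pair_graph U \<delta> \<beta>))))"
    by (rule sum.swap)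
  also have "\<dots> = mark_conv G U (marks G f) (marks G h) \<alpha> \<beta>"
    unfolding mark_conv_def marks_def sum_product ..
  finally show ?thesis .
qed

lemma class_fun_mark: "subgroup N (G \<times>\<times> G) \<Longrightarrow> class_fun G (mark (G \<times>\<times> G) N)"
  unfolding class_fun_def using P.mark_conj(2)[OF finP] subgroup.subset by blast

lemma class_fun_marks: "class_fun G (marks G f)"
  using class_fun_mark sub_classes_rep(1) unfolding class_fun_def marks_def by (auto intro!: sum.cong)

lemma class_fun_ind: "subgroup L (G \<times>\<times> G) \<Longrightarrow> class_fun G (class_ind G L)"
  unfolding class_fun_def class_ind_def
proof (intro allI impI arg_cong[where f = of_bool])
  fix K x assume L: "subgroup L (G \<times>\<times> G)" "subgroup K (G \<times>\<times> G)" "x \<in> carrier (G \<times>\<times> G)"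
  note K = subgroup.subset[OF L(2)]
  have "conj_sub (G \<times>\<times> G) x K \<in> conj_class (G \<times>\<times> G) K" using L by (auto simp: conj_class_def)
  from P.conj_class_eq[OF K this]
  show "(conj_sub (G \<times>\<times> G) x K \<in> conj_class (G \<times>\<times> G) L) = (K \<in> conj_class (G \<times>\<times> G) L)"
    using P.conj_class_eq[OF subgroup.subset[OF L(1)]] P.conj_class_self[OF K]
      P.conj_class_self[OF P.conj_sub_subset[OF L(3) K]] by metis
qed

lemma left_free_conj:
  assumes L: "subgroup L (G \<times>\<times> G)" "left_free G L" and x: "x \<in> carrier (G \<times>\<times> G)"
  shows "left_free G (conj_sub (G \<times>\<times> G) x L)"
proof -
  obtain a b where ab: "x = (a, b)" "a \<in> carrier G" "b \<in> carrier G" using x by auto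
  have "(\<one>, \<one>) \<in> conj_sub (G \<times>\<times> G) x L"
    using subgroup.one_closed[OF P.subgroup_conj_sub[OF x L(1)]] by simp
  moreover have "g = \<one>" if g: "g \<in> carrier G" "(g, \<one>) \<in> conj_sub (G \<times>\<times> G) x L" for g
  proof -
    have "(inv a \<otimes> g \<otimes> a, \<one>) \<in> L"
      using P.conj_mem_iff[of x "(g, \<one>)" L] g ab subgroup.subset[OF L(1)] by (simp add: invP)
    then have "inv a \<otimes> g \<otimes> a = \<one>" using L(2) g ab by (auto simp: left_free_def k1_def)
    then have "inv a \<otimes> (g \<otimes> a) = \<one>" using ab g by (simp add: m_assoc)
    then have "g \<otimes> a = a" using ab g inv_mult_eq_oneD[of a "g \<otimes> a"] by simp
    then show ?thesis using ab g by simp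
  qed
  ultimately show ?thesis by (auto simp: left_free_def k1_def)
qed

lemma left_free_subset:
  assumes "subgroup K (G \<times>\<times> G)" "K \<subseteq> L" "left_free G L"
  shows "left_free G K"
  using assms subgroup.one_closed[OF assms(1)] by (auto simp: left_free_def k1_def)

lemma mark_left_free:
  assumes "subgroup N (G \<times>\<times> G)" "left_free G N" "subgroup K (G \<times>\<times> G)" "mark (G \<times>\<times> G) N K \<noteq> 0"
  shows "left_free G K"
  using P.mark_nonzero_obtain[OF finP assms(1) subgroup.subset[OF assms(3)] assms(4)]
    left_free_conj[OF assms(1,2)] left_free_subset[OF assms(3)] by metis

text \<open>Triangularity of the table of marks with respect to group order: a nonzero mark places K
  inside a conjugate of N.\<close>

lemma mark_nonzero_card:
  assumes N: "subgroup N (G \<times>\<times> G)" and K: "subgroup K (G \<times>\<times> G)" and nz: "mark (G \<times>\<times> G) N K \<noteq> 0"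
  shows "card K \<le> card N" and "card K = card N \<Longrightarrow> K \<in> conj_class (G \<times>\<times> G) N"
proof -
  obtain x where x: "x \<in> carrier (G \<times>\<times> G)" "K \<subseteq> conj_sub (G \<times>\<times> G) x N"
    using P.mark_nonzero_obtain[OF finP N subgroup.subset[OF K] nz] .
  note c = P.card_conj_sub[OF x(1) subgroup.subset[OF N]]
  have f: "finite (conj_sub (G \<times>\<times> G) x N)"
    using finite_subset[OF P.conj_sub_subset[OF x(1) subgroup.subset[OF N]] finP] .
  show "card K \<le> card N" using card_mono[OF f x(2)] c by simp
  assume "card K = card N"
  then have "K = conj_sub (G \<times>\<times> G) x N" using card_subset_eq[OF f x(2)] c by simp
  then show "K \<in> conj_class (G \<times>\<times> G) N" using x by (auto simp: conj_class_def)
qed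

text \<open>Injectivity of the mark map on left-free elements. For a class C in the support of f
  whose groups have the largest order, triangularity leaves only the term of C in the mark at
  \<open>rep C\<close>, and the diagonal mark there is a nonzero integer.\<close>

lemma marks_eq_zero:
  fixes f :: "('g \<times> 'g) set set \<Rightarrow> 'r::{idom, ring_char_0}"
  assumes f: "f \<in> RB_left_free G"
    and z: "\<And>K. subgroup K (G \<times>\<times> G) \<Longrightarrow> left_free G K \<Longrightarrow> marks G f K = 0"
  shows "f = (\<lambda>_. 0)"
proof (rule ccontr)
  define S where "S = {A \<in> sub_classes G. f A \<noteq> 0}"
  assume "f \<noteq> (\<lambda>_. 0)"
  then have "S \<noteq> {}" using f by (auto simp: RB_left_free_def S_def)
  moreover have "finite S" using finite_sub_classes by (simp add: S_def)
  ultimately obtain C where C: "C \<in> S" and Cmax: "\<And>D. D \<in> S \<Longrightarrow> card (rep D) \<le> card (rep C)"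
    using Max_in[of "(\<lambda>D. card (rep D)) ` S"] Max_ge[of "(\<lambda>D. card (rep D)) ` S"]
    by (metis (no_types, lifting) finite_imageI imageE image_eqI image_is_empty)
  have Cs: "C \<in> sub_classes G" "f C \<noteq> 0" using C by (auto simp: S_def)
  note sub = sub_classes_rep[OF Cs(1)]
  have "marks G f (rep C) = (\<Sum>A\<in>sub_classes G. if A = C then f C * of_nat (mark (G \<times>\<times> G) (rep C) (rep C)) else 0)"
    unfolding marks_def
  proof (rule sum.cong[OF refl])
    fix A assume A: "A \<in> sub_classes G"
    note subA = sub_classes_rep[OF A]
    have "f A * of_nat (mark (G \<times>\<times> G) (rep A) (rep C)) = 0" if "A \<noteq> C"
    proof (rule ccontr)
      assume nz: "f A * of_nat (mark (G \<times>\<times> G) (rep A) (rep C)) \<noteq> 0"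
      then have nz': "mark (G \<times>\<times> G) (rep A) (rep C) \<noteq> 0" by auto
      from nz A have "A \<in> S" by (auto simp: S_def)
      then have "rep C \<in> conj_class (G \<times>\<times> G) (rep A)"
        using mark_nonzero_card[OF subA(1) sub(1) nz'] Cmax by force
      then have "C = A"
        using P.conj_class_eq[OF subgroup.subset[OF subA(1)]] subA sub by metis
      then show False using that by simp
    qed
    then show "f A * of_nat (mark (G \<times>\<times> G) (rep A) (rep C)) =
        (if A = C then f C * of_nat (mark (G \<times>\<times> G) (rep C) (rep C)) else 0)" by auto
  qed
  also have "\<dots> = f C * of_nat (mark (G \<times>\<times> G) (rep C) (rep C))"
    using Cs finite_sub_classes by simp
  also have "\<dots> \<noteq> 0" using Cs P.mark_self_nonzero[OF finP sub(1)] by simp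
  finally show False using z[OF sub(1)] f Cs by (auto simp: RB_left_free_def)
qed

lemma marks_single:
  assumes L: "subgroup L (G \<times>\<times> G)" and K: "subgroup K (G \<times>\<times> G)"
  shows "marks G (\<lambda>A. of_bool (A = conj_class (G \<times>\<times> G) L)) K = of_nat (mark (G \<times>\<times> G) L K)"
proof -
  have "marks G (\<lambda>A. of_bool (A = conj_class (G \<times>\<times> G) L)) K =
      of_nat (mark (G \<times>\<times> G) (rep (conj_class (G \<times>\<times> G) L)) K)"
    unfolding marks_def using finite_sub_classes conj_class_in_sub_classes[OF L]
    by (simp add: of_bool_def if_distrib[of "\<lambda>u. u * _"] cong: if_cong)
  then show ?thesis
    using P.mark_conj_class[OF finP subgroup.subset[OF K] L P.rep_in_conj_class[OF L]] by simp
qed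

lemma single_RB_left_free:
  assumes L: "subgroup L (G \<times>\<times> G)" "left_free G L"
  shows "(\<lambda>A. of_bool (A = conj_class (G \<times>\<times> G) L)) \<in> RB_left_free G"
proof -
  obtain x where "x \<in> carrier (G \<times>\<times> G)" "rep (conj_class (G \<times>\<times> G) L) = conj_sub (G \<times>\<times> G) x L"
    using P.rep_in_conj_class[OF L(1)] by (auto simp: conj_class_def)
  then show ?thesis
    using left_free_conj[OF L] conj_class_in_sub_classes[OF L(1)] by (auto simp: RB_left_free_def)
qed

text \<open>A mark is constant on conjugacy classes, hence a combination of their indicators; this
  relation is inverted by induction in \<open>class_ind_commute\<close>.\<close>

lemma mark_decomp:
  assumes L: "subgroup L (G \<times>\<times> G)" and K: "subgroup K (G \<times>\<times> G)"
  shows "(of_nat (mark (G \<times>\<times> G) L K) :: 'r::comm_ring_1) =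
    (\<Sum>C\<in>sub_classes G. of_nat (mark (G \<times>\<times> G) L (rep C)) * class_ind G (rep C) K)"
proof -
  let ?C = "conj_class (G \<times>\<times> G) K"
  have "class_ind G (rep C) K = (of_bool (C = ?C) :: 'r)" if C: "C \<in> sub_classes G" for C
  proof -
    have "K \<in> C \<longleftrightarrow> C = ?C"
      using P.conj_class_eq[OF subgroup.subset[OF sub_classes_rep(1)[OF C]], of K]
        sub_classes_rep(2)[OF C] P.conj_class_self[OF subgroup.subset[OF K]] by auto
    then show ?thesis by (simp add: class_ind_def sub_classes_rep(2)[OF C])
  qed
  then have "(\<Sum>C\<in>sub_classes G. of_nat (mark (G \<times>\<times> G) L (rep C)) * class_ind G (rep C) K) =
     (\<Sum>C\<in>sub_classes G. of_nat (mark (G \<times>\<times> G) L (rep C)) * (of_bool (C = ?C) :: 'r))"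
    by (intro sum.cong) auto
  also have "\<dots> = of_nat (mark (G \<times>\<times> G) L (rep ?C))"
    using finite_sub_classes conj_class_in_sub_classes[OF K]
    by (simp add: of_bool_def if_distrib[of "\<lambda>u. _ * u"] cong: if_cong)
  also have "mark (G \<times>\<times> G) L (rep ?C) = mark (G \<times>\<times> G) L K"
    using P.rep_in_conj_class[OF K] class_fun_mark[OF L] K by (auto simp: class_fun_def conj_class_def)
  finally show ?thesis by simp
qed

text \<open>The indicator functions of conjugacy classes are rational combinations of marks of transitive
  bisets; integral domains of characteristic 0 being torsion free, commutation descends to them.\<close>

lemma class_ind_commute:
  fixes E :: "('g \<times> 'g) set \<Rightarrow> 'r::{idom, ring_char_0}"
  assumes U: "subgroup U G" and \<alpha>: "\<alpha> \<in> homs G U" and \<beta>: "\<beta> \<in> homs G U"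
    and comm: "\<And>f. f \<in> RB_left_free G \<Longrightarrow> mark_conv G U E (marks G f) \<alpha> \<beta> = mark_conv G U (marks G f) E \<alpha> \<beta>"
    and L: "subgroup L (G \<times>\<times> G)" "left_free G L"
  shows "mark_conv G U E (class_ind G L) \<alpha> \<beta> = mark_conv G U (class_ind G L) E \<alpha> \<beta>"
  using L
proof (induction "card L" arbitrary: L rule: less_induct)
  case less
  note L = less.prems
  let ?S = "sub_classes G" and ?m = "\<lambda>N K. of_nat (mark (G \<times>\<times> G) N K) :: 'r" and ?C = "conj_class (G \<times>\<times> G) L"
  \<comment> \<open>The commutator with E, linear in F. It vanishes on the mark function of L by
    assumption, and is now expanded in indicators.\<close>
  define Z where "Z F = mark_conv G U E F \<alpha> \<beta> - mark_conv G U F E \<alpha> \<beta>" for F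
  have sub: "subgroup (pair_graph U \<delta> \<epsilon>) (G \<times>\<times> G)" if "\<delta> \<in> homs G U" "\<epsilon> \<in> homs G U" for \<delta> \<epsilon>
    using subgroup_pair_graph[OF U that] .
  have single: "marks G (\<lambda>A. of_bool (A = ?C)) K = ?m L K" and
    decomp: "?m L K = (\<Sum>C\<in>?S. ?m L (rep C) * class_ind G (rep C) K)" if "subgroup K (G \<times>\<times> G)" for K
    using marks_single[OF L(1) that] mark_decomp[OF L(1) that] by blast+
  have "Z (?m L) = Z (marks G (\<lambda>A. of_bool (A = ?C)))"
    unfolding Z_def mark_conv_def
    by (intro arg_cong2[where f = minus] sum.cong refl) (simp_all only: single sub \<alpha> \<beta>)
  also have "\<dots> = 0" using comm[OF single_RB_left_free[OF L]] by (simp add: Z_def)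
  finally have "0 = Z (?m L)" by simp
  also have "\<dots> = Z (\<lambda>K. \<Sum>C\<in>?S. ?m L (rep C) * class_ind G (rep C) K)"
    unfolding Z_def mark_conv_def
    by (intro arg_cong2[where f = minus] sum.cong refl) (simp_all only: decomp[OF sub] \<alpha> \<beta>)
  also have "\<dots> = (\<Sum>C\<in>?S. ?m L (rep C) * Z (class_ind G (rep C)))"
    unfolding Z_def mark_conv_def
    by (simp add: sum_distrib_left sum_distrib_right right_diff_distrib sum_subtractf sum.swap[of _ ?S] mult_ac)
  \<comment> \<open>A different class with nonzero mark consists of left-free groups of smaller
    order, so the induction hypothesis removes it. What survives is \<open>Z\<close> of the
    indicator of L times the nonzero integer \<open>mark (G \<times>\<times> G) L L\<close>, which
    can be cancelled.\<close>
  also have "\<dots> = (\<Sum>C\<in>?S. if C = ?C then ?m L (rep ?C) * Z (class_ind G (rep ?C)) else 0)"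
  proof (rule sum.cong[OF refl])
    fix C assume C: "C \<in> ?S"
    note subC = sub_classes_rep[OF C]
    have "?m L (rep C) * Z (class_ind G (rep C)) = 0" if "C \<noteq> ?C"
    proof (cases "mark (G \<times>\<times> G) L (rep C) = 0")
      case False
      have "left_free G (rep C)" using mark_left_free[OF L subC(1) False] .
      moreover have "card (rep C) < card L"
      proof -
        have "rep C \<notin> ?C" using P.conj_class_eq[OF subgroup.subset[OF L(1)], of "rep C"] subC that by auto
        then show ?thesis using mark_nonzero_card[OF L(1) subC(1) False] by force
      qed
      ultimately show ?thesis using less.hyps[of "rep C"] subC(1) by (simp add: Z_def)
    qed simp
    then show "?m L (rep C) * Z (class_ind G (rep C)) = (if C = ?C then ?m L (rep ?C) * Z (class_ind G (rep ?C)) else 0)"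
      by auto
  qed
  also have "\<dots> = ?m L (rep ?C) * Z (class_ind G (rep ?C))"
    using finite_sub_classes conj_class_in_sub_classes[OF L(1)] by simp
  also have "class_ind G (rep ?C) = (class_ind G L :: _ \<Rightarrow> 'r)"
    by (rule ext) (simp add: class_ind_def P.conj_class_rep[OF L(1)])
  also have "mark (G \<times>\<times> G) L (rep ?C) = mark (G \<times>\<times> G) L L"
    using P.rep_in_conj_class[OF L(1)] class_fun_mark[OF L(1)] L(1) by (auto simp: class_fun_def conj_class_def)
  finally show ?case using P.mark_self_nonzero[OF finP L(1)] by (simp add: Z_def)
qed

lemma conjh_homs:
  assumes U: "subgroup U G" and \<alpha>: "\<alpha> \<in> homs G U" and g: "g \<in> carrier G"
  shows "conjh G U g \<alpha> \<in> homs G U"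
proof -
  have "g \<otimes> \<alpha> (u \<otimes> v) \<otimes> inv g = (g \<otimes> \<alpha> u \<otimes> inv g) \<otimes> (g \<otimes> \<alpha> v \<otimes> inv g)" if "u \<in> U" "v \<in> U" for u v
  proof -
    note c = homs_closed[OF \<alpha> that(1)] homs_closed[OF \<alpha> that(2)] g
    have "inv g \<otimes> (g \<otimes> (\<alpha> v \<otimes> inv g)) = \<alpha> v \<otimes> inv g" using c by (simp add: m_assoc[symmetric])
    then show ?thesis using c homs_mult[OF \<alpha> that] by (simp add: m_assoc)
  qed
  then show ?thesis
    unfolding homs_def conjh_def using homs_closed[OF \<alpha>] g subgroup.m_closed[OF U] by auto
qed

lemma pair_graph_conjh:
  assumes "\<alpha> \<in> homs G U" "\<beta> \<in> homs G U" "g \<in> carrier G" "h \<in> carrier G"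
  shows "pair_graph U (conjh G U g \<alpha>) (conjh G U h \<beta>) = conj_sub (G \<times>\<times> G) (g, h) (pair_graph U \<alpha> \<beta>)"
  unfolding pair_graph_def conj_sub_def image_image conjh_def using assms
  by (intro image_cong) (auto simp: invP)

lemma conjh_one: "\<alpha> \<in> homs G U \<Longrightarrow> conjh G U \<one> \<alpha> = \<alpha>"
  unfolding conjh_def homs_def by (auto simp: fun_eq_iff restrict_def PiE_def extensional_def Pi_def)

text \<open>Conjugation by (g, h) in G \<times> G conjugates the two homomorphisms independently, so
  matrices of class functions are constant on G-conjugacy classes in each index.\<close>

lemma class_fun_conjh:
  assumes "class_fun G F" "subgroup U G" "\<alpha> \<in> homs G U" "\<beta> \<in> homs G U" "g \<in> carrier G" "h \<in> carrier G"
  shows "F (pair_graph U (conjh G U g \<alpha>) (conjh G U h \<beta>)) = F (pair_graph U \<alpha> \<beta>)"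
  using assms subgroup_pair_graph[OF assms(2-4)] by (simp add: pair_graph_conjh class_fun_def)

lemma class_fun_conjh1:
  assumes "class_fun G F" "subgroup U G" "\<alpha> \<in> homs G U" "\<beta> \<in> homs G U" "g \<in> carrier G"
  shows "F (pair_graph U (conjh G U g \<alpha>) \<beta>) = F (pair_graph U \<alpha> \<beta>)" "F (pair_graph U \<alpha> (conjh G U g \<beta>)) = F (pair_graph U \<alpha> \<beta>)"
  using class_fun_conjh[OF assms(1-5) one_closed] class_fun_conjh[OF assms(1-4) one_closed assms(5)]
    conjh_one assms(3,4) by simp_all

end

text \<open>Write d/m as d'/m' in lowest terms; m' > 1 because 0 < d < m. For a prime p dividing m',
  the element d' lies in pR, and Bezout for the coprime pair d', p puts 1 into pR. This is precisely
  what the hypothesis on primes forbids.\<close>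

lemma prime_unit_of_fraction:
  fixes \<epsilon> :: "'r::{idom, ring_char_0}"
  assumes eq: "of_nat m * \<epsilon> = of_nat d" and d: "0 < d" "d < m"
  obtains p :: nat where "Factorial_Ring.prime p" "p dvd m" "of_nat p dvd (1::'r)"
proof -
  define g where "g = gcd d m"
  have g0: "g \<noteq> 0" using d by (simp add: g_def)
  obtain d' m' where dm: "d = g * d'" "m = g * m'" by (metis dvdE g_def gcd_dvd1 gcd_dvd2)
  have "coprime d' m'"
    using dm g0 d by (metis div_gcd_coprime g_def gr_implies_not0 nonzero_mult_div_cancel_left)
  have "m' \<noteq> 1"
  proof
    assume "m' = 1"
    with dm d g0 show False by (cases d') auto
  qed
  then obtain p where p: "Factorial_Ring.prime p" "p dvd m'" using prime_factor_nat by blast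
  have "of_nat g * (of_nat m' * \<epsilon>) = of_nat g * (of_nat d' :: 'r)" using eq dm by (simp add: mult.assoc)
  then have eq': "of_nat m' * \<epsilon> = (of_nat d' :: 'r)" using g0 by simp
  obtain c where c: "m' = p * c" using p(2) by blast
  have "coprime d' p" using \<open>coprime d' m'\<close> p(2) coprime_divisors[of d' d' p m'] by auto
  then have "coprime (int d') (int p)" by simp
  then obtain x y where xy: "x * int d' + y * int p = 1" by (metis coprime_imp_gcd_eq_1 bezout_int)
  have "(1::'r) = of_int (x * int d' + y * int p)" using xy by simp
  also have "\<dots> = of_int x * (of_nat m' * \<epsilon>) + of_int y * of_nat p" by (simp add: eq')
  also have "\<dots> = of_nat p * (of_int x * of_nat c * \<epsilon> + of_int y)" by (simp add: c algebra_simps)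
  finally have "of_nat p dvd (1::'r)" by (metis dvd_triv_left)
  moreover have "p dvd m" using p(2) dm by simp
  ultimately show thesis using p(1) that by blast
qed

lemma (in gset) card_orb_stab:
  assumes "finite (carrier P)" "x \<in> \<Omega>"
  shows "card (carrier P) = card (stab x) * card (orb x)"
proof -
  have "{s \<in> carrier P. act s x \<in> orb x} = carrier P" by (auto simp: orb_def)
  then show ?thesis using card_act_into[OF assms subset_refl] by simp
qed

text \<open>With stabilizers of constant order s all orbits have the same length |P|/s, which
  therefore divides |\<Omega>|. It is applied with s = 1 and with orders of centralizers.\<close>

lemma (in gset) card_dvd_of_stab:
  assumes fin: "finite (carrier P)" and fin\<Omega>: "finite \<Omega>" and s: "\<And>x. x \<in> \<Omega> \<Longrightarrow> card (stab x) = s"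
  shows "card (carrier P) dvd card \<Omega> * s"
proof (cases "\<Omega> = {}")
  case False
  then obtain x0 where x0: "x0 \<in> \<Omega>" by blast
  have "card (carrier P) \<noteq> 0" using fin one_closed by (auto simp: card_eq_0_iff)
  then have s0: "s \<noteq> 0" using card_orb_stab[OF fin x0] s[OF x0] by (metis mult_0)
  have "card \<Omega> = card (orb x0) * card (orb ` \<Omega>)"
  proof (rule card_fibres[of _ orb])
    fix q assume "q \<in> orb ` \<Omega>"
    then obtain x where x: "x \<in> \<Omega>" "q = orb x" by blast
    have "{y \<in> \<Omega>. orb y = q} = orb x"
    proof (intro equalityI subsetI)
      fix y assume "y \<in> {y \<in> \<Omega>. orb y = q}"
      then show "y \<in> orb x" using x orb_self by auto
    next
      fix y assume "y \<in> orb x"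
      then obtain s where "s \<in> carrier P" "y = act s x" by (auto simp: orb_def)
      then show "y \<in> {y \<in> \<Omega>. orb y = q}" using x act_closed orb_eqI by simp
    qed
    moreover have "card (orb x) = card (orb x0)"
      using card_orb_stab[OF fin x(1)] card_orb_stab[OF fin x0] s[OF x(1)] s[OF x0] s0 by simp
    ultimately show "card {y \<in> \<Omega>. orb y = q} = card (orb x0)" by simp
  qed (use fin\<Omega> in auto)
  then have "card \<Omega> * s = card (carrier P) * card (orb ` \<Omega>)"
    using card_orb_stab[OF fin x0] s[OF x0] by simp
  then show ?thesis by simp
qed simp

section \<open>Centralizers and the matrix of the identity biset\<close>

definition incl :: "'g set \<Rightarrow> 'g \<Rightarrow> 'g" where "incl U = (\<lambda>u\<in>U. u)"

definition cent :: "('g, 'b) monoid_scheme \<Rightarrow> 'g set \<Rightarrow> 'g set" where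
  "cent G U = {g \<in> carrier G. \<forall>u\<in>U. g \<otimes>\<^bsub>G\<^esub> u = u \<otimes>\<^bsub>G\<^esub> g}"

context fin_group
begin

lemma incl_homs: "subgroup U G \<Longrightarrow> incl U \<in> homs G U"
  unfolding homs_def incl_def using subgroup.subset subgroup.m_closed by fastforce

lemma pair_graph_incl: "pair_graph U (incl U) (incl U) = {(u, u) | u. u \<in> U}"
  by (auto simp: pair_graph_def incl_def)

lemma subgroup_cent:
  assumes "subgroup U G"
  shows "subgroup (cent G U) G"
proof (rule subgroupI)
  note Uc = subgroup.mem_carrier[OF assms]
  show "cent G U \<noteq> {}" using Uc one_closed by (auto simp: cent_def)
  fix a assume a: "a \<in> cent G U"
  have "inv a \<otimes> u = u \<otimes> inv a" if u: "u \<in> U" for u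
  proof -
    have "a \<otimes> u = u \<otimes> a" using a u by (simp add: cent_def)
    then have "u = inv a \<otimes> (u \<otimes> a)" using a Uc[OF u] inv_solve_left[of u a "u \<otimes> a"] by (simp add: cent_def)
    then show ?thesis
      using a Uc[OF u] inv_solve_right[of "inv a \<otimes> u" u a] by (simp add: cent_def m_assoc)
  qed
  then show "inv a \<in> cent G U" using a by (simp add: cent_def)
  fix b assume b: "b \<in> cent G U"
  have "a \<otimes> b \<otimes> u = u \<otimes> (a \<otimes> b)" if u: "u \<in> U" for u
  proof -
    have "a \<otimes> b \<otimes> u = a \<otimes> (u \<otimes> b)" using a b u Uc[OF u] by (simp add: cent_def m_assoc)
    also have "\<dots> = a \<otimes> u \<otimes> b" using a b Uc[OF u] by (simp add: cent_def m_assoc)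
    also have "\<dots> = u \<otimes> (a \<otimes> b)" using a b u Uc[OF u] by (simp add: cent_def m_assoc)
    finally show ?thesis .
  qed
  then show "a \<otimes> b \<in> cent G U" using a b by (simp add: cent_def)
qed (auto simp: cent_def)

text \<open>The group \<open>cent G U \<times> 1\<close> acts freely on the fixed points, since the biset is left-free.\<close>

lemma card_cent_dvd_mark:
  assumes U: "subgroup U G" and N: "subgroup N (G \<times>\<times> G)" "left_free G N"
  shows "card (cent G U) dvd mark (G \<times>\<times> G) N (pair_graph U (incl U) (incl U))"
proof -
  interpret t: tensor G N N using N by (intro tensor.intro tensor_axioms.intro fin_group_axioms)
  let ?X = "left_cosets (G \<times>\<times> G) N"
  let ?F = "{x \<in> ?X. \<forall>k\<in>pair_graph U (incl U) (incl U). k <#\<^bsub>G \<times>\<times> G\<^esub> x = x}"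
  let ?C = "G\<lparr>carrier := cent G U\<rparr>"
  have "group ?C" using subgroup.subgroup_is_group[OF subgroup_cent[OF U] is_group] .
  moreover have "gset_axioms ?C ?F (\<lambda>c x. (c, \<one>) <#\<^bsub>G \<times>\<times> G\<^esub> x)"
  proof
    fix s x assume s: "s \<in> carrier ?C" and x: "x \<in> ?F"
    then have sc: "s \<in> carrier G" and xX: "x \<in> ?X" by (auto simp: cent_def)
    \<comment> \<open>Since s centralizes u, the elements (s, 1) and (u, u) commute, so (s, 1)
      permutes the fixed points of the diagonal of U.\<close>
    have "(u, u) <#\<^bsub>G \<times>\<times> G\<^esub> ((s, \<one>) <#\<^bsub>G \<times>\<times> G\<^esub> x) = (s, \<one>) <#\<^bsub>G \<times>\<times> G\<^esub> x" if u: "u \<in> U" for u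
    proof -
      have uc: "u \<in> carrier G" using subgroup.mem_carrier[OF U u] .
      have "(u, u) <#\<^bsub>G \<times>\<times> G\<^esub> ((s, \<one>) <#\<^bsub>G \<times>\<times> G\<^esub> x) = (s, \<one>) <#\<^bsub>G \<times>\<times> G\<^esub> ((u, u) <#\<^bsub>G \<times>\<times> G\<^esub> x)"
        using s u uc sc xX by (simp add: t.L_act_mult cent_def)
      then show ?thesis using x u by (auto simp: pair_graph_incl)
    qed
    then show "(s, \<one>) <#\<^bsub>G \<times>\<times> G\<^esub> x \<in> ?F" using t.L_act_closed[OF sc one_closed xX] by (auto simp: pair_graph_incl)
  qed (auto simp: t.L_act_mult t.L_act_one cent_def)
  ultimately interpret c: gset ?C ?F "\<lambda>c x. (c, \<one>) <#\<^bsub>G \<times>\<times> G\<^esub> x"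
    by (rule gset.intro)
  have "card (carrier ?C) dvd card ?F * 1"
  proof (rule c.card_dvd_of_stab)
    show "finite (carrier ?C)" using fin by (simp add: cent_def)
    show "finite ?F" using t.finite_cosets by simp
    fix x assume x: "x \<in> ?F"
    have "c.stab x = {\<one>}"
    proof (intro equalityI subsetI)
      fix s assume "s \<in> c.stab x"
      then have "s \<in> cent G U" "(s, \<one>) <#\<^bsub>G \<times>\<times> G\<^esub> x = x" unfolding c.stab_def by simp_all
      then show "s \<in> {\<one>}" using t.M_free[OF N(2), of s x] x by (simp add: cent_def)
    next
      fix s assume "s \<in> {\<one>}"
      then show "s \<in> c.stab x" using x c.one_closed t.L_act_one by (auto simp: c.stab_def)
    qed
    then show "card (c.stab x) = 1" by simp
  qed
  then show ?thesis by (simp add: mark_def)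
qed

text \<open>Provides the quotient by |C(U)| inside R. Extracting this factor is what reduces the
  denominator in the trace equation to a divisor of |Out(U)|.\<close>

lemma cent_dvd_marks:
  assumes f: "f \<in> RB_left_free G" and U: "subgroup U G"
  shows "of_nat (card (cent G U)) dvd marks G f (pair_graph U (incl U) (incl U))"
  unfolding marks_def
proof (rule dvd_sum)
  fix A assume A: "A \<in> sub_classes G"
  show "of_nat (card (cent G U)) dvd f A * of_nat (mark (G \<times>\<times> G) (rep A) (pair_graph U (incl U) (incl U)))"
  proof (cases "f A = 0")
    case False
    then have "left_free G (rep A)" using f by (auto simp: RB_left_free_def)
    from card_cent_dvd_mark[OF U sub_classes_rep(1)[OF A] this]
    show ?thesis by (metis dvd_def dvd_mult of_nat_mult)
  qed simp
qed

lemma subgroup_diag: "subgroup (diag G) (G \<times>\<times> G)"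
proof -
  have "subgroup (carrier G) G" by (rule subgroup_self)
  moreover have "diag G = pair_graph (carrier G) (incl (carrier G)) (incl (carrier G))"
    by (auto simp: pair_graph_incl diag_def)
  ultimately show ?thesis using subgroup_pair_graph incl_homs by metis
qed

lemma left_free_diag: "left_free G (diag G)"
  by (auto simp: left_free_def k1_def diag_def)

lemma bs_one_eq: "bs_one G = (\<lambda>A. of_bool (A = conj_class (G \<times>\<times> G) (diag G)))"
  by (auto simp: bs_one_def)

lemma bs_one_RB: "bs_one G \<in> RB_left_free G"
  unfolding bs_one_eq by (rule single_RB_left_free[OF subgroup_diag left_free_diag])

lemma marks_one: "subgroup K (G \<times>\<times> G) \<Longrightarrow> marks G (bs_one G) K = of_nat (mark (G \<times>\<times> G) (diag G) K)"
  unfolding bs_one_eq by (rule marks_single[OF subgroup_diag])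

lemma card_diag: "card (diag G) = card (carrier G)"
proof -
  have "diag G = (\<lambda>g. (g, g)) ` carrier G" by (auto simp: diag_def)
  then show ?thesis by (simp add: card_image inj_on_def)
qed

lemma conjh_conjh:
  assumes "\<alpha> \<in> homs G U" "g \<in> carrier G" "h \<in> carrier G"
  shows "conjh G U g (conjh G U h \<alpha>) = conjh G U (g \<otimes> h) \<alpha>"
  unfolding conjh_def using assms homs_closed[OF assms(1)]
  by (auto simp: fun_eq_iff inv_mult_group m_assoc)

lemma conjh_eq_iff:
  assumes U: "subgroup U G" and \<alpha>: "\<alpha> \<in> homs G U" and \<beta>: "\<beta> \<in> homs G U"
    and g: "g \<in> carrier G" and h: "h \<in> carrier G"
  shows "conjh G U g \<alpha> = conjh G U h \<beta> \<longleftrightarrow> \<beta> = conjh G U (inv h \<otimes> g) \<alpha>"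
proof -
  have "conjh G U (inv h) (conjh G U g \<alpha>) = conjh G U (inv h \<otimes> g) \<alpha>"
    "conjh G U (inv h) (conjh G U h \<beta>) = \<beta>"
    "conjh G U h (conjh G U (inv h \<otimes> g) \<alpha>) = conjh G U g \<alpha>"
    using assms by (simp_all add: conjh_conjh conjh_one m_assoc[symmetric])
  then show ?thesis by metis
qed

text \<open>\<open>diag G\<close> is a point stabilizer of the identity biset, so its marks count
  the elements of G conjugating one homomorphism to the other; b a^-1 is such an element.\<close>

lemma diag_transporter:
  assumes U: "subgroup U G" and \<alpha>: "\<alpha> \<in> homs G U" and \<beta>: "\<beta> \<in> homs G U"
  shows "transporter (G \<times>\<times> G) (pair_graph U \<alpha> \<beta>) (diag G) =
    {(a, b) \<in> carrier G \<times> carrier G. \<beta> = conjh G U (b \<otimes> inv a) \<alpha>}"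
proof -
  have *: "(\<forall>k\<in>pair_graph U \<alpha> \<beta>. inv\<^bsub>G \<times>\<times> G\<^esub> (a, b) \<otimes>\<^bsub>G \<times>\<times> G\<^esub> k \<otimes>\<^bsub>G \<times>\<times> G\<^esub> (a, b) \<in> diag G) \<longleftrightarrow>
      \<beta> = conjh G U (b \<otimes> inv a) \<alpha>" if ab: "a \<in> carrier G" "b \<in> carrier G" for a b
  proof -
    have "(\<forall>k\<in>pair_graph U \<alpha> \<beta>. inv\<^bsub>G \<times>\<times> G\<^esub> (a, b) \<otimes>\<^bsub>G \<times>\<times> G\<^esub> k \<otimes>\<^bsub>G \<times>\<times> G\<^esub> (a, b) \<in> diag G) \<longleftrightarrow>
        (\<forall>u\<in>U. inv a \<otimes> \<alpha> u \<otimes> a = inv b \<otimes> \<beta> u \<otimes> b)"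
      using ab homs_closed[OF \<alpha>] homs_closed[OF \<beta>] by (auto simp: pair_graph_def invP diag_def)
    also have "\<dots> \<longleftrightarrow> conjh G U (inv a) \<alpha> = conjh G U (inv b) \<beta>"
      using ab by (auto simp: conjh_def fun_eq_iff restrict_def)
    also have "\<dots> \<longleftrightarrow> \<beta> = conjh G U (b \<otimes> inv a) \<alpha>"
      using conjh_eq_iff[OF U \<alpha> \<beta>] ab by simp
    finally show ?thesis .
  qed
  show ?thesis
  proof (rule Set.set_eqI)
    fix w
    show "w \<in> transporter (G \<times>\<times> G) (pair_graph U \<alpha> \<beta>) (diag G) \<longleftrightarrow>
        w \<in> {(a, b) \<in> carrier G \<times> carrier G. \<beta> = conjh G U (b \<otimes> inv a) \<alpha>}"
    proof (cases w)
      case (Pair a b)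
      show ?thesis
        unfolding Pair transporter_def mem_Collect_eq case_prod_conv carrier_DirProd mem_Sigma_iff
        using *[of a b] by (rule conj_cong[OF refl]) auto
    qed
  qed
qed

text \<open>The matrix of the identity biset is not diagonal: its (\<alpha>, \<delta>) entry is the
  number of g conjugating \<alpha> to \<delta>. Summing an invariant F against a row or a column
  still gives |G| F \<alpha>. The equation is first multiplied by |G|, so that marks become
  transporter counts.\<close>

lemma sum_marks_one:
  fixes F :: "('g \<Rightarrow> 'g) \<Rightarrow> 'r::{idom, ring_char_0}"
  assumes U: "subgroup U G" and \<alpha>: "\<alpha> \<in> homs G U"
    and F: "\<And>g. g \<in> carrier G \<Longrightarrow> F (conjh G U g \<alpha>) = F \<alpha>"
  shows "(\<Sum>\<delta>\<in>homs G U. marks G (bs_one G) (pair_graph U \<alpha> \<delta>) * F \<delta>) = of_nat (card (carrier G)) * F \<alpha>" (is ?L)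
    and "(\<Sum>\<delta>\<in>homs G U. marks G (bs_one G) (pair_graph U \<delta> \<alpha>) * F \<delta>) = of_nat (card (carrier G)) * F \<alpha>" (is ?R)
proof -
  let ?n = "card (carrier G)" and ?c = "\<lambda>a b. conjh G U (b \<otimes> inv a) \<alpha>"
  have n0: "(of_nat ?n :: 'r) \<noteq> 0" using fin one_closed by auto
  have one: "of_nat ?n * marks G (bs_one G) (pair_graph U \<beta> \<gamma>) =
      (of_nat (card (transporter (G \<times>\<times> G) (pair_graph U \<beta> \<gamma>) (diag G))) :: 'r)"
    if \<beta>: "\<beta> \<in> homs G U" and \<gamma>: "\<gamma> \<in> homs G U" for \<beta> \<gamma>
    unfolding marks_one[OF subgroup_pair_graph[OF U \<beta> \<gamma>]] P.mark_transp[OF finP subgroup_diag pair_graph_subset[OF \<beta> \<gamma>], symmetric]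
      card_diag by (simp add: mult.commute)
  \<comment> \<open>Each pair (a, b) is counted for exactly one \<delta>, and by invariance it
    contributes F \<alpha>; there are |G|^2 pairs.\<close>
  have key: "(\<Sum>\<delta>\<in>homs G U. of_nat (card {(a, b) \<in> carrier G \<times> carrier G. \<delta> = ?c a b}) * F \<delta>) =
      of_nat ?n * (of_nat ?n * F \<alpha>)"
  proof -
    have "(\<Sum>\<delta>\<in>homs G U. of_nat (card {(a, b) \<in> carrier G \<times> carrier G. \<delta> = ?c a b}) * F \<delta>) =
        (\<Sum>\<delta>\<in>homs G U. \<Sum>(a, b)\<in>{w \<in> carrier G \<times> carrier G. (\<lambda>(a, b). ?c a b) w = \<delta>}. F (?c a b))"
    proof (rule sum.cong[OF refl])
      fix \<delta>
      have "{(a, b) \<in> carrier G \<times> carrier G. \<delta> = ?c a b} = {w \<in> carrier G \<times> carrier G. (\<lambda>(a, b). ?c a b) w = \<delta>}"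
        by auto
      moreover have "(\<Sum>(a, b)\<in>{w \<in> carrier G \<times> carrier G. (\<lambda>(a, b). ?c a b) w = \<delta>}. F (?c a b)) =
          (\<Sum>w\<in>{w \<in> carrier G \<times> carrier G. (\<lambda>(a, b). ?c a b) w = \<delta>}. F \<delta>)"
        by (intro sum.cong) auto
      ultimately show "of_nat (card {(a, b) \<in> carrier G \<times> carrier G. \<delta> = ?c a b}) * F \<delta> =
          (\<Sum>(a, b)\<in>{w \<in> carrier G \<times> carrier G. (\<lambda>(a, b). ?c a b) w = \<delta>}. F (?c a b))"
        by simp
    qed
    also have "\<dots> = (\<Sum>(a, b)\<in>carrier G \<times> carrier G. F (?c a b))"
      using fin finite_homs[OF U] conjh_homs[OF U \<alpha>] by (intro sum.group) auto
    also have "\<dots> = (\<Sum>(a, b)\<in>carrier G \<times> carrier G. F \<alpha>)"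
      using F by (intro sum.cong) auto
    also have "\<dots> = of_nat ?n * (of_nat ?n * F \<alpha>)"
      by (simp add: case_prod_beta card_cartesian_product)
    finally show ?thesis .
  qed
  have "of_nat ?n * (\<Sum>\<delta>\<in>homs G U. marks G (bs_one G) (pair_graph U \<alpha> \<delta>) * F \<delta>) =
      (\<Sum>\<delta>\<in>homs G U. of_nat (card {(a, b) \<in> carrier G \<times> carrier G. \<delta> = ?c a b}) * F \<delta>)"
    unfolding sum_distrib_left mult.assoc[symmetric]
    by (intro sum.cong refl) (simp add: one \<alpha> diag_transporter[OF U \<alpha>])
  then show ?L using key n0 by simp
  \<comment> \<open>Reversing the roles of \<alpha> and \<delta> inverts the conjugating element b
    a^-1, that is, exchanges a and b.\<close>
  have swap: "card (transporter (G \<times>\<times> G) (pair_graph U \<delta> \<alpha>) (diag G)) = card {(a, b) \<in> carrier G \<times> carrier G. \<delta> = ?c a b}"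
    if \<delta>: "\<delta> \<in> homs G U" for \<delta>
  proof -
    have eq: "\<alpha> = conjh G U (b \<otimes> inv a) \<delta> \<longleftrightarrow> \<delta> = ?c b a" if "a \<in> carrier G" "b \<in> carrier G" for a b
      using conjh_eq_iff[OF U \<alpha> \<delta>, of \<one> "b \<otimes> inv a"] conjh_one[OF \<alpha>] that by (simp add: inv_mult_group)
    have "bij_betw (\<lambda>(a, b). (b, a)) (transporter (G \<times>\<times> G) (pair_graph U \<delta> \<alpha>) (diag G))
        {(a, b) \<in> carrier G \<times> carrier G. \<delta> = ?c a b}"
    proof -
      have "transporter (G \<times>\<times> G) (pair_graph U \<delta> \<alpha>) (diag G) = {(a, b) \<in> carrier G \<times> carrier G. \<delta> = ?c b a}"
        unfolding diag_transporter[OF U \<delta> \<alpha>] using eq by blast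
      then show ?thesis by (auto intro!: bij_betwI[where g = "\<lambda>(a, b). (b, a)"])
    qed
    then show ?thesis by (rule bij_betw_same_card)
  qed
  have "of_nat ?n * (\<Sum>\<delta>\<in>homs G U. marks G (bs_one G) (pair_graph U \<delta> \<alpha>) * F \<delta>) =
      (\<Sum>\<delta>\<in>homs G U. of_nat (card {(a, b) \<in> carrier G \<times> carrier G. \<delta> = ?c a b}) * F \<delta>)"
    unfolding sum_distrib_left mult.assoc[symmetric]
    by (intro sum.cong refl) (simp add: one \<alpha> swap)
  then show ?R using key n0 by simp
qed

lemma mark_conv_one:
  fixes F :: "('g \<times> 'g) set \<Rightarrow> 'r::{idom, ring_char_0}"
  assumes F: "class_fun G F" and U: "subgroup U G" and \<alpha>: "\<alpha> \<in> homs G U" and \<beta>: "\<beta> \<in> homs G U"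
  shows "mark_conv G U (marks G (bs_one G)) F \<alpha> \<beta> = of_nat (card (carrier G)) * F (pair_graph U \<alpha> \<beta>)"
    and "mark_conv G U F (marks G (bs_one G)) \<alpha> \<beta> = of_nat (card (carrier G)) * F (pair_graph U \<alpha> \<beta>)"
  using sum_marks_one(1)[OF U \<alpha>, of "\<lambda>\<delta>. F (pair_graph U \<delta> \<beta>)"] sum_marks_one(2)[OF U \<beta>, of "\<lambda>\<delta>. F (pair_graph U \<alpha> \<delta>)"]
    class_fun_conjh1[OF F U \<alpha> \<beta>]
  by (simp_all add: mark_conv_def mult.commute)

text \<open>The elements conjugating the inclusion to itself are those of C(U). Hence if e has
  diagonal entry |C(U)| x, then 1 - e has |C(U)| (1 - x).\<close>

lemma marks_one_incl:
  assumes U: "subgroup U G"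
  shows "marks G (bs_one G) (pair_graph U (incl U) (incl U)) = of_nat (card (cent G U))"
proof -
  note i = incl_homs[OF U]
  have c: "incl U = conjh G U g (incl U) \<longleftrightarrow> g \<in> cent G U" if g: "g \<in> carrier G" for g
  proof -
    have "incl U = conjh G U g (incl U) \<longleftrightarrow> (\<forall>u\<in>U. u = g \<otimes> u \<otimes> inv g)"
      by (auto simp: incl_def conjh_def fun_eq_iff restrict_def)
    also have "\<dots> \<longleftrightarrow> (\<forall>u\<in>U. u \<otimes> g = g \<otimes> u)"
      using g inv_solve_right[of _ _ g] subgroup.mem_carrier[OF U] by auto
    finally show ?thesis using g by (auto simp: cent_def)
  qed
  have "bij_betw (\<lambda>(a, g). (a, g \<otimes> a)) (carrier G \<times> cent G U)
     {(a, b) \<in> carrier G \<times> carrier G. incl U = conjh G U (b \<otimes> inv a) (incl U)}"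
    by (intro bij_betwI[where g = "\<lambda>(a, b). (a, b \<otimes> inv a)"])
       (auto simp: c m_assoc cent_def)
  then have "card (transporter (G \<times>\<times> G) (pair_graph U (incl U) (incl U)) (diag G)) = card (carrier G) * card (cent G U)"
    unfolding diag_transporter[OF U i i] by (simp add: bij_betw_same_card[symmetric] card_cartesian_product)
  then have "mark (G \<times>\<times> G) (diag G) (pair_graph U (incl U) (incl U)) * card (carrier G) = card (cent G U) * card (carrier G)"
    using P.mark_transp[OF finP subgroup_diag pair_graph_subset[OF i i]] by (simp add: card_diag mult.commute)
  moreover have "card (carrier G) \<noteq> 0" using fin one_closed by auto
  ultimately show ?thesis using marks_one[OF subgroup_pair_graph[OF U i i]] by simp
qed

end

section \<open>Matrices of central idempotents\<close>

text \<open>The conjugates of automorphisms of U, described through their images. Injectivity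
  follows, as the image has as many elements as U.\<close>

definition conj_embs :: "('g, 'b) monoid_scheme \<Rightarrow> 'g set \<Rightarrow> ('g \<Rightarrow> 'g) set" where
  "conj_embs G U = {\<alpha> \<in> homs G U. \<exists>g\<in>carrier G. \<alpha> ` U = conj_sub G g U}"

lemma mark_conv_diff:
  "mark_conv G U (\<lambda>K. E K - E' K) F \<alpha> \<beta> = mark_conv G U E F \<alpha> \<beta> - mark_conv G U E' F \<alpha> \<beta>"
  "mark_conv G U F (\<lambda>K. E K - E' K) \<alpha> \<beta> = mark_conv G U F E \<alpha> \<beta> - mark_conv G U F E' \<alpha> \<beta>"
  by (simp_all add: mark_conv_def left_diff_distrib right_diff_distrib sum_subtractf)

text \<open>What the block argument uses of E, stated so that the marks of e and those of 1 - e are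
  both instances.\<close>

locale central_ghost = fin_group G for G :: "('g, 'b) monoid_scheme" (structure) +
  fixes E :: "('g \<times> 'g) set \<Rightarrow> 'r::{idom, ring_char_0}"
  assumes cf: "class_fun G E"
    and idem: "subgroup U G \<Longrightarrow> \<alpha> \<in> homs G U \<Longrightarrow> \<beta> \<in> homs G U \<Longrightarrow>
      of_nat (card (carrier G)) * E (pair_graph U \<alpha> \<beta>) = mark_conv G U E E \<alpha> \<beta>"
    and comm: "subgroup U G \<Longrightarrow> \<alpha> \<in> homs G U \<Longrightarrow> \<beta> \<in> homs G U \<Longrightarrow>
      subgroup L (G \<times>\<times> G) \<Longrightarrow> left_free G L \<Longrightarrow> mark_conv G U E (class_ind G L) \<alpha> \<beta> = mark_conv G U (class_ind G L) E \<alpha> \<beta>"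

context fin_group
begin

lemma central_ghost_marks:
  fixes e :: "('g \<times> 'g) set set \<Rightarrow> 'r::{idom, ring_char_0}"
  assumes "central_idempotent G e"
  shows "central_ghost G (marks G e)"
proof (intro central_ghost.intro central_ghost_axioms.intro fin_group_axioms class_fun_marks)
  have e: "e \<in> RB_left_free G" "bs_mult G e e = e" "\<And>f. f \<in> RB_left_free G \<Longrightarrow> bs_mult G e f = bs_mult G f e"
    using assms by (auto simp: central_idempotent_def)
  fix U \<alpha> \<beta> assume U: "subgroup U G" and h: "\<alpha> \<in> homs G U" "\<beta> \<in> homs G U"
  show "of_nat (card (carrier G)) * marks G e (pair_graph U \<alpha> \<beta>) = mark_conv G U (marks G e) (marks G e) \<alpha> \<beta>"
    using marks_bs_mult[OF e(1) U h, of e] e(2) by simp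
  fix L assume L: "subgroup L (G \<times>\<times> G)" "left_free G L"
  show "mark_conv G U (marks G e) (class_ind G L) \<alpha> \<beta> = mark_conv G U (class_ind G L) (marks G e) \<alpha> \<beta>"
  proof (rule class_ind_commute[OF U h _ L])
    fix f :: "('g \<times> 'g) set set \<Rightarrow> 'r" assume f: "f \<in> RB_left_free G"
    show "mark_conv G U (marks G e) (marks G f) \<alpha> \<beta> = mark_conv G U (marks G f) (marks G e) \<alpha> \<beta>"
      using marks_bs_mult[OF f U h, of e] marks_bs_mult[OF e(1) U h, of f] e(3)[OF f] by simp
  qed
qed

text \<open>The marks of 1 act as the scalar |G| on class functions from either side, so (1 - E)(1 -
  E) = |G| (1 - E) and commutation are inherited from E.\<close>

lemma central_ghost_complement:
  fixes E :: "('g \<times> 'g) set \<Rightarrow> 'r::{idom, ring_char_0}"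
  assumes "central_ghost G E"
  shows "central_ghost G (\<lambda>K. marks G (bs_one G) K - E K)"
proof -
  interpret E: central_ghost G E by fact
  show ?thesis
  proof (intro central_ghost.intro central_ghost_axioms.intro fin_group_axioms)
    show "class_fun G (\<lambda>K. marks G (bs_one G) K - E K)"
      using E.cf class_fun_marks[of "bs_one G :: _ \<Rightarrow> 'r"] by (simp add: class_fun_def)
    fix U \<alpha> \<beta> assume h: "subgroup U G" "\<alpha> \<in> homs G U" "\<beta> \<in> homs G U"
    show "of_nat (card (carrier G)) * (marks G (bs_one G) (pair_graph U \<alpha> \<beta>) - E (pair_graph U \<alpha> \<beta>)) =
      mark_conv G U (\<lambda>K. marks G (bs_one G) K - E K) (\<lambda>K. marks G (bs_one G) K - E K) \<alpha> \<beta>"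
      by (simp add: mark_conv_diff mark_conv_one[OF E.cf h] mark_conv_one[OF class_fun_marks h] E.idem[OF h] algebra_simps)
    fix L assume L: "subgroup L (G \<times>\<times> G)" "left_free G L"
    show "mark_conv G U (\<lambda>K. marks G (bs_one G) K - E K) (class_ind G L) \<alpha> \<beta> =
      mark_conv G U (class_ind G L) (\<lambda>K. marks G (bs_one G) K - E K) \<alpha> \<beta>"
      by (simp add: mark_conv_diff mark_conv_one[OF class_fun_ind[OF L(1)] h] E.comm[OF h L])
  qed
qed

lemma incl_conj_embs: "subgroup U G \<Longrightarrow> incl U \<in> conj_embs G U"
  using incl_homs one_closed conj_sub_one[OF subgroup.subset]
  unfolding conj_embs_def by (force simp: incl_def)

lemma conj_embs_inj:
  assumes U: "subgroup U G" and \<alpha>: "\<alpha> \<in> conj_embs G U"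
  shows "inj_on \<alpha> U"
proof (rule eq_card_imp_inj_on)
  show "finite U" using finite_subset[OF subgroup.subset[OF U] fin] .
  show "card (\<alpha> ` U) = card U"
    using \<alpha> card_conj_sub[OF _ subgroup.subset[OF U]] by (auto simp: conj_embs_def)
qed

lemma conj_embs_conjh:
  assumes U: "subgroup U G" and \<alpha>: "\<alpha> \<in> conj_embs G U" and g: "g \<in> carrier G"
  shows "conjh G U g \<alpha> \<in> conj_embs G U"
proof -
  obtain h where h: "h \<in> carrier G" "\<alpha> ` U = conj_sub G h U" and \<alpha>h: "\<alpha> \<in> homs G U"
    using \<alpha> by (auto simp: conj_embs_def)
  have "conjh G U g \<alpha> ` U = conj_sub G g (\<alpha> ` U)" by (auto simp: conjh_def conj_sub_def)
  also have "\<dots> = conj_sub G (g \<otimes> h) U"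
    using h g conj_sub_mult[OF g h(1) subgroup.subset[OF U]] by simp
  finally show ?thesis using g h conjh_homs[OF U \<alpha>h g] by (auto simp: conj_embs_def)
qed

lemma pair_graph_self_conj_class:
  assumes U: "subgroup U G" and \<alpha>: "\<alpha> \<in> conj_embs G U"
  obtains g where "g \<in> carrier G" "pair_graph U \<alpha> \<alpha> = conj_sub (G \<times>\<times> G) (g, g) (pair_graph U (incl U) (incl U))"
proof -
  obtain g where g: "g \<in> carrier G" "\<alpha> ` U = conj_sub G g U" using \<alpha> by (auto simp: conj_embs_def)
  have "pair_graph U \<alpha> \<alpha> = (\<lambda>v. (v, v)) ` \<alpha> ` U" by (auto simp: pair_graph_def)
  also have "\<dots> = conj_sub (G \<times>\<times> G) (g, g) (pair_graph U (incl U) (incl U))"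
    unfolding g(2) conj_sub_def pair_graph_def image_image using g(1) by (intro image_cong) (auto simp: incl_def invP)
  finally show thesis using g(1) that by blast
qed

text \<open>Read as a matrix, the indicator of the class of the diagonal of U is supported on S
  \<times> S, where it has entry 1 exactly at pairs conjugate in G; here S is
  \<open>conj_embs G U\<close>.\<close>

lemma class_ind_incl_iff:
  assumes U: "subgroup U G" and \<alpha>: "\<alpha> \<in> homs G U" and \<beta>: "\<beta> \<in> homs G U"
  shows "pair_graph U \<alpha> \<beta> \<in> conj_class (G \<times>\<times> G) (pair_graph U (incl U) (incl U)) \<longleftrightarrow>
    \<alpha> \<in> conj_embs G U \<and> (\<exists>g\<in>carrier G. \<beta> = conjh G U g \<alpha>)" (is "?l = ?r")
proof
  assume ?l
  then obtain g h where gh: "g \<in> carrier G" "h \<in> carrier G"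
    "pair_graph U \<alpha> \<beta> = conj_sub (G \<times>\<times> G) (g, h) (pair_graph U (incl U) (incl U))"
    by (auto simp: conj_class_def)
  have eq: "pair_graph U \<alpha> \<beta> = (\<lambda>v. (g \<otimes> v \<otimes> inv g, h \<otimes> v \<otimes> inv h)) ` U"
    unfolding gh(3) using gh(1,2) by (auto simp: conj_sub_def pair_graph_def incl_def invP image_image)
  have "\<alpha> ` U = fst ` pair_graph U \<alpha> \<beta>" by (auto simp: pair_graph_def image_image)
  also have "\<dots> = conj_sub G g U" unfolding eq by (auto simp: image_image conj_sub_def)
  finally have "\<alpha> \<in> conj_embs G U" using gh \<alpha> by (auto simp: conj_embs_def)
  moreover have "\<beta> = conjh G U (h \<otimes> inv g) \<alpha>"
  proof (rule homs_ext[OF \<beta> conjh_homs[OF U \<alpha>]])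
    fix u assume u: "u \<in> U"
    then have "(\<alpha> u, \<beta> u) \<in> pair_graph U \<alpha> \<beta>" by (auto simp: pair_graph_def)
    then obtain v where v: "v \<in> U" "\<alpha> u = g \<otimes> v \<otimes> inv g" "\<beta> u = h \<otimes> v \<otimes> inv h" unfolding eq by auto
    have vc: "v \<in> carrier G" using subgroup.mem_carrier[OF U v(1)] .
    have "h \<otimes> inv g \<otimes> (g \<otimes> v \<otimes> inv g) \<otimes> inv (h \<otimes> inv g) = h \<otimes> ((inv g \<otimes> g) \<otimes> v \<otimes> (inv g \<otimes> g)) \<otimes> inv h"
      using gh vc by (simp only: inv_mult_group inv_inv m_assoc m_closed inv_closed)
    then show "\<beta> u = conjh G U (h \<otimes> inv g) \<alpha> u" using u v gh vc by (simp add: conjh_def)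
  qed (use gh in simp)
  ultimately show ?r using gh by blast
next
  assume ?r
  then obtain k where \<alpha>S: "\<alpha> \<in> conj_embs G U" and k: "k \<in> carrier G" "\<beta> = conjh G U k \<alpha>" by blast
  obtain g where g: "g \<in> carrier G" "pair_graph U \<alpha> \<alpha> = conj_sub (G \<times>\<times> G) (g, g) (pair_graph U (incl U) (incl U))"
    using pair_graph_self_conj_class[OF U \<alpha>S] .
  have "pair_graph U \<alpha> \<beta> = conj_sub (G \<times>\<times> G) (\<one>, k) (pair_graph U \<alpha> \<alpha>)"
    using pair_graph_conjh[OF \<alpha> \<alpha> one_closed k(1)] conjh_one[OF \<alpha>] k(2) by simp
  also have "\<dots> = conj_sub (G \<times>\<times> G) ((\<one>, k) \<otimes>\<^bsub>G \<times>\<times> G\<^esub> (g, g)) (pair_graph U (incl U) (incl U))"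
    unfolding g(2) using g(1) k(1) pair_graph_subset[OF incl_homs[OF U] incl_homs[OF U]]
    by (intro P.conj_sub_mult[symmetric]) auto
  finally show ?l using g(1) k(1) by (auto simp: conj_class_def)
qed

lemma left_free_pair_graph_incl:
  assumes U: "subgroup U G" and \<alpha>: "\<alpha> \<in> homs G U"
  shows "left_free G (pair_graph U \<alpha> (incl U))"
  using subgroup.one_closed[OF U] homs_one[OF U \<alpha>]
  by (auto simp: left_free_def k1_def pair_graph_def incl_def image_iff)

end

context central_ghost
begin

text \<open>\<open>E\<close> commutes with the projection onto the span of the conjugates of automorphisms of \<open>U\<close>.\<close>

lemma off_diagonal_zero:
  assumes U: "subgroup U G" and \<alpha>: "\<alpha> \<in> homs G U" "\<alpha> \<notin> conj_embs G U" and \<beta>: "\<beta> \<in> conj_embs G U"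
  shows "E (pair_graph U \<alpha> \<beta>) = 0"
proof -
  let ?L = "pair_graph U (incl U) (incl U)"
  note i = incl_homs[OF U]
  have \<beta>h: "\<beta> \<in> homs G U" using \<beta> by (auto simp: conj_embs_def)
  \<comment> \<open>The support of the column \<beta> of the indicator: the conjugates of \<beta>,
    among them \<beta> itself. On D the row E(\<alpha>, .) is constant, so one product is |D|
    E(\<alpha>, \<beta>); the other is 0, because \<alpha> \<notin> S makes the row \<alpha> of the
    indicator vanish.\<close>
  define D where "D = {\<delta> \<in> homs G U. pair_graph U \<delta> \<beta> \<in> conj_class (G \<times>\<times> G) ?L}"
  have D: "E (pair_graph U \<alpha> \<delta>) = E (pair_graph U \<alpha> \<beta>)" if "\<delta> \<in> D" for \<delta>
  proof -
    have "\<delta> \<in> homs G U" using that by (auto simp: D_def)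
    then show ?thesis
      using that class_ind_incl_iff[OF U _ \<beta>h] class_fun_conjh1(2)[OF cf U \<alpha>(1)] by (auto simp: D_def)
  qed
  have "mark_conv G U E (class_ind G ?L) \<alpha> \<beta> = (\<Sum>\<delta>\<in>homs G U. if \<delta> \<in> D then E (pair_graph U \<alpha> \<beta>) else 0)"
    unfolding mark_conv_def
  proof (rule sum.cong[OF refl])
    fix \<delta> assume "\<delta> \<in> homs G U"
    then show "E (pair_graph U \<alpha> \<delta>) * class_ind G ?L (pair_graph U \<delta> \<beta>) = (if \<delta> \<in> D then E (pair_graph U \<alpha> \<beta>) else 0)"
      using D[of \<delta>] by (auto simp: class_ind_def D_def)
  qed
  also have "\<dots> = of_nat (card D) * E (pair_graph U \<alpha> \<beta>)"
    using finite_homs[OF U] by (simp add: sum.If_cases D_def Int_def)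
  finally have "of_nat (card D) * E (pair_graph U \<alpha> \<beta>) = mark_conv G U E (class_ind G ?L) \<alpha> \<beta>" by simp
  also have "\<dots> = mark_conv G U (class_ind G ?L) E \<alpha> \<beta>"
    by (rule comm[OF U \<alpha>(1) \<beta>h subgroup_pair_graph[OF U i i] left_free_pair_graph_incl[OF U i]])
  also have "\<dots> = 0"
    unfolding mark_conv_def using class_ind_incl_iff[OF U \<alpha>(1)] \<alpha>(2) by (intro sum.neutral) (auto simp: class_ind_def)
  finally have "of_nat (card D) * E (pair_graph U \<alpha> \<beta>) = 0" .
  moreover have "card D \<noteq> 0"
  proof -
    have "\<beta> \<in> D" using class_ind_incl_iff[OF U \<beta>h \<beta>h] \<beta> \<beta>h conjh_one[OF \<beta>h] by (force simp: D_def)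
    moreover have "finite D" using finite_homs[OF U] by (simp add: D_def)
    ultimately show ?thesis by auto
  qed
  ultimately show ?thesis by simp
qed

text \<open>Entries E(\<delta>, \<beta>) with \<beta> in S and \<delta> outside vanish, so the
  S-block by itself satisfies E^2 = |G| E. Its diagonal entries agree because the graphs of
  (\<alpha>, \<alpha>) are conjugate to the diagonal of U. If d = 0, the block vanishes, and so does
  the entire column of the inclusion.\<close>

lemma trace_conj_embs:
  assumes U: "subgroup U G"
  obtains d where
    "of_nat (card (conj_embs G U)) * E (pair_graph U (incl U) (incl U)) = of_nat (card (carrier G)) * of_nat d"
    "d = 0 \<Longrightarrow> \<forall>\<alpha>\<in>homs G U. E (pair_graph U \<alpha> (incl U)) = 0"
proof -
  let ?S = "conj_embs G U"
  have S: "?S \<subseteq> homs G U" by (auto simp: conj_embs_def)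
  have "(\<Sum>\<delta>\<in>?S. E (pair_graph U \<alpha> \<delta>) * E (pair_graph U \<delta> \<beta>)) = of_nat (card (carrier G)) * E (pair_graph U \<alpha> \<beta>)"
    if "\<alpha> \<in> ?S" "\<beta> \<in> ?S" for \<alpha> \<beta>
  proof -
    have "mark_conv G U E E \<alpha> \<beta> = (\<Sum>\<delta>\<in>?S. E (pair_graph U \<alpha> \<delta>) * E (pair_graph U \<delta> \<beta>))"
      unfolding mark_conv_def using off_diagonal_zero[OF U] that
      by (intro sum.mono_neutral_right finite_homs[OF U] S) auto
    then show ?thesis using idem[OF U subsetD[OF S that(1)] subsetD[OF S that(2)]] by simp
  qed
  then obtain d where d: "(\<Sum>\<alpha>\<in>?S. E (pair_graph U \<alpha> \<alpha>)) = of_nat (card (carrier G)) * of_nat d"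
    and d0: "d = 0 \<Longrightarrow> \<forall>\<alpha>\<in>?S. \<forall>\<beta>\<in>?S. E (pair_graph U \<alpha> \<beta>) = 0"
    using trace_scaled_idempotent[of ?S "\<lambda>\<alpha> \<beta>. E (pair_graph U \<alpha> \<beta>)" "of_nat (card (carrier G))"]
      finite_subset[OF S finite_homs[OF U]] by blast
  have "E (pair_graph U \<alpha> \<alpha>) = E (pair_graph U (incl U) (incl U))" if \<alpha>: "\<alpha> \<in> ?S" for \<alpha>
    using pair_graph_self_conj_class[OF U \<alpha>] cf subgroup_pair_graph[OF U incl_homs[OF U] incl_homs[OF U]]
    unfolding class_fun_def by (metis SigmaI carrier_DirProd)
  then have "(\<Sum>\<alpha>\<in>?S. E (pair_graph U \<alpha> \<alpha>)) = of_nat (card ?S) * E (pair_graph U (incl U) (incl U))" by simp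
  moreover have "\<forall>\<alpha>\<in>homs G U. E (pair_graph U \<alpha> (incl U)) = 0" if "d = 0"
    using d0[OF that] off_diagonal_zero[OF U _ _ incl_conj_embs[OF U]] incl_conj_embs[OF U] by blast
  ultimately show thesis using that d by metis
qed

text \<open>Commuting with the indicator of the class of \<open>1 \<times> U\<close> links the component of \<open>U\<close>
  to that of the trivial group.\<close>

lemma zero_at_one:
  assumes U: "subgroup U G" and z: "\<forall>\<alpha>\<in>homs G U. E (pair_graph U \<alpha> (incl U)) = 0"
  shows "E {(\<one>, \<one>)} = 0"
proof -
  define t where "t = (\<lambda>u\<in>U. \<one>)"
  let ?L = "pair_graph U t (incl U)"
  have t: "t \<in> homs G U" using subgroup.m_closed[OF U] by (auto simp: t_def homs_def)
  note i = incl_homs[OF U]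
  \<comment> \<open>Conjugation keeps a trivial first coordinate trivial, so the indicator has a
    single 1 in the column of the inclusion. At (t, \<open>incl U\<close>), multiplying E by it
    extracts E(t, t), the value at the trivial group, whereas the opposite product involves only the
    entries E(\<delta>, \<open>incl U\<close>), all 0.\<close>
  have iff: "pair_graph U \<delta> (incl U) \<in> conj_class (G \<times>\<times> G) ?L \<longleftrightarrow> \<delta> = t" if \<delta>: "\<delta> \<in> homs G U" for \<delta>
  proof
    assume "pair_graph U \<delta> (incl U) \<in> conj_class (G \<times>\<times> G) ?L"
    then obtain g h where gh: "g \<in> carrier G" "h \<in> carrier G" "pair_graph U \<delta> (incl U) = conj_sub (G \<times>\<times> G) (g, h) ?L"
      by (auto simp: conj_class_def)
    show "\<delta> = t"
    proof (rule homs_ext[OF \<delta> t])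
      fix u assume u: "u \<in> U"
      then have "(\<delta> u, incl U u) \<in> conj_sub (G \<times>\<times> G) (g, h) ?L" unfolding gh(3)[symmetric] by (auto simp: pair_graph_def)
      then show "\<delta> u = t u" using u gh by (auto simp: conj_sub_def pair_graph_def t_def invP)
    qed
  next
    assume "\<delta> = t"
    then show "pair_graph U \<delta> (incl U) \<in> conj_class (G \<times>\<times> G) ?L"
      using P.conj_class_self[OF pair_graph_subset[OF t i]] by simp
  qed
  have "mark_conv G U E (class_ind G ?L) t (incl U) = (\<Sum>\<delta>\<in>homs G U. if \<delta> = t then E (pair_graph U t t) else 0)"
    unfolding mark_conv_def by (intro sum.cong refl) (auto simp: class_ind_def iff)
  also have "\<dots> = E (pair_graph U t t)" using finite_homs[OF U] t by simp
  also have "pair_graph U t t = {(\<one>, \<one>)}" using subgroup.one_closed[OF U] by (auto simp: pair_graph_def t_def)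
  finally have "E {(\<one>, \<one>)} = mark_conv G U E (class_ind G ?L) t (incl U)" by simp
  also have "\<dots> = mark_conv G U (class_ind G ?L) E t (incl U)"
    by (rule comm[OF U t i subgroup_pair_graph[OF U t i] left_free_pair_graph_incl[OF U t]])
  also have "\<dots> = 0" unfolding mark_conv_def using z by (intro sum.neutral) auto
  finally show ?thesis .
qed

end

section \<open>From the vanishing of blocks to the idempotent\<close>

context fin_group
begin

lemma left_free_obtain:
  assumes K: "subgroup K (G \<times>\<times> G)" "left_free G K"
  obtains U \<alpha> where "subgroup U G" "\<alpha> \<in> homs G U" "K = pair_graph U \<alpha> (incl U)"
proof -
  define U where "U = snd ` K"
  have Kc: "a \<in> carrier G \<and> b \<in> carrier G" if "(a, b) \<in> K" for a b
    using subgroup.subset[OF K(1)] that by auto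
  have Km: "(a \<otimes> c, b \<otimes> d) \<in> K" if "(a, b) \<in> K" "(c, d) \<in> K" for a b c d
    using subgroup.m_closed[OF K(1) that] by simp
  have Ki: "(inv a, inv b) \<in> K" if "(a, b) \<in> K" for a b
    using subgroup.m_inv_closed[OF K(1) that] Kc[OF that] by (simp add: invP)
  have uniq: "a = a'" if "(a, b) \<in> K" "(a', b) \<in> K" for a a' b
  proof -
    have "(inv a' \<otimes> a, \<one>) \<in> K" using Km[OF Ki[OF that(2)] that(1)] Kc[OF that(1)] by simp
    then have "inv a' \<otimes> a = \<one>" using K(2) Kc[OF that(1)] Kc[OF that(2)] by (auto simp: left_free_def k1_def)
    then show ?thesis using inv_mult_eq_oneD Kc that by blast
  qed
  define \<alpha> where "\<alpha> = (\<lambda>u\<in>U. THE a. (a, u) \<in> K)"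
  have \<alpha>: "\<alpha> b = a" if "(a, b) \<in> K" for a b
    using that uniq by (auto simp: \<alpha>_def U_def image_iff intro!: the_equality)
  have "subgroup U G"
  proof (rule subgroupI)
    show "U \<subseteq> carrier G" using Kc by (auto simp: U_def)
    show "U \<noteq> {}" using subgroup.one_closed[OF K(1)] by (auto simp: U_def)
    show "inv a \<in> U" if "a \<in> U" for a using that Ki by (force simp: U_def)
    show "a \<otimes> b \<in> U" if "a \<in> U" "b \<in> U" for a b using that Km by (force simp: U_def)
  qed
  moreover have "\<alpha> \<in> homs G U"
    unfolding homs_def
  proof (intro CollectI conjI ballI)
    show "\<alpha> \<in> U \<rightarrow>\<^sub>E carrier G"
    proof
      fix u assume "u \<in> U" then show "\<alpha> u \<in> carrier G" using \<alpha> Kc by (auto simp: U_def)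
    qed (simp add: \<alpha>_def)
    fix u v assume "u \<in> U" "v \<in> U"
    then show "\<alpha> (u \<otimes> v) = \<alpha> u \<otimes> \<alpha> v" using \<alpha> Km by (force simp: U_def)
  qed
  moreover have "K = pair_graph U \<alpha> (incl U)"
  proof (intro equalityI subsetI)
    fix w assume "w \<in> K"
    then show "w \<in> pair_graph U \<alpha> (incl U)" using \<alpha> by (cases w) (force simp: pair_graph_def incl_def U_def image_iff)
  next
    fix w assume "w \<in> pair_graph U \<alpha> (incl U)"
    then show "w \<in> K" using \<alpha> by (auto simp: pair_graph_def incl_def U_def)
  qed
  ultimately show thesis by (rule that)
qed

text \<open>With x the quotient of the diagonal entry by |C(U)|, the trace equation becomes m x = d
  after cancelling |G|. The same computation for 1 - e gives m (1 - x) = d', and a proper fraction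
  d/m would force a prime divisor of m to be a unit.\<close>

lemma central_ghost_dichotomy:
  fixes e :: "('g \<times> 'g) set set \<Rightarrow> 'r::{idom, ring_char_0}"
  assumes e: "central_idempotent G e" and U: "subgroup U G"
    and m: "card (conj_embs G U) * card (cent G U) = card (carrier G) * m"
    and hm: "\<And>p. Factorial_Ring.prime p \<Longrightarrow> p dvd m \<Longrightarrow> \<not> of_nat p dvd (1::'r)"
  shows "(\<forall>\<alpha>\<in>homs G U. marks G e (pair_graph U \<alpha> (incl U)) = 0) \<or>
    (\<forall>\<alpha>\<in>homs G U. marks G (bs_one G) (pair_graph U \<alpha> (incl U)) - marks G e (pair_graph U \<alpha> (incl U)) = 0)"
proof -
  let ?i = "pair_graph U (incl U) (incl U)" and ?n = "card (carrier G)" and ?c = "card (cent G U)"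
    and ?s = "card (conj_embs G U)"
  have n0: "(of_nat ?n :: 'r) \<noteq> 0" using fin one_closed by auto
  have c0: "(of_nat ?c :: 'r) \<noteq> 0"
    using subgroup.one_closed[OF subgroup_cent[OF U]] finite_subset[OF subgroup.subset[OF subgroup_cent[OF U]] fin] by auto
  interpret E: central_ghost G "marks G e" using e by (rule central_ghost_marks)
  interpret F: central_ghost G "\<lambda>K. marks G (bs_one G) K - marks G e K"
    using E.central_ghost_axioms by (rule central_ghost_complement)
  obtain d where d: "of_nat ?s * marks G e ?i = of_nat ?n * of_nat d"
    and d0: "d = 0 \<Longrightarrow> \<forall>\<alpha>\<in>homs G U. marks G e (pair_graph U \<alpha> (incl U)) = 0"
    using E.trace_conj_embs[OF U] by blast
  obtain d' where d': "of_nat ?s * (marks G (bs_one G) ?i - marks G e ?i) = of_nat ?n * of_nat d'"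
    and d0': "d' = 0 \<Longrightarrow> \<forall>\<alpha>\<in>homs G U. marks G (bs_one G) (pair_graph U \<alpha> (incl U)) - marks G e (pair_graph U \<alpha> (incl U)) = 0"
    using F.trace_conj_embs[OF U] by blast
  obtain \<epsilon> where \<epsilon>: "marks G e ?i = of_nat ?c * \<epsilon>"
    using cent_dvd_marks[OF _ U, of e] e by (auto simp: central_idempotent_def dvd_def)
  have sc: "of_nat ?s * of_nat ?c = (of_nat ?n * of_nat m :: 'r)"
    using m by (metis of_nat_mult)
  have "of_nat ?n * (of_nat m * \<epsilon>) = of_nat ?n * (of_nat d :: 'r)"
    using d \<epsilon> sc by (metis mult.assoc)
  then have md: "of_nat m * \<epsilon> = of_nat d" using n0 by simp
  have one: "marks G (bs_one G) ?i = (of_nat ?c :: 'r)" by (rule marks_one_incl[OF U])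
  have "of_nat ?s * of_nat ?c = of_nat ?n * (of_nat d + of_nat d' :: 'r)"
    using d d' unfolding one by (simp add: algebra_simps)
  then have "of_nat m = (of_nat (d + d') :: 'r)" using sc n0 by simp
  \<comment> \<open>The passage from R back to natural numbers uses characteristic 0; it yields 0 <
    d < m as soon as d and d' are both nonzero.\<close>
  then have mdd: "m = d + d'" by (metis of_nat_eq_iff)
  have "d = 0 \<or> d' = 0"
  proof (rule ccontr)
    assume "\<not> (d = 0 \<or> d' = 0)"
    then show False using prime_unit_of_fraction[OF md] mdd hm by auto
  qed
  then show ?thesis using d0 d0' by blast
qed

text \<open>The value of E at the trivial group decides for every U simultaneously: if it is
  nonzero, the column of e cannot vanish for any U, and if it is zero, that of 1 - e cannot. The
  remaining alternative kills all marks of 1 - e or of e.\<close>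

theorem central_idempotent_trivial:
  fixes e :: "('g \<times> 'g) set set \<Rightarrow> 'r::{idom, ring_char_0}"
  assumes e: "central_idempotent G e"
    and m: "\<And>U. subgroup U G \<Longrightarrow> \<exists>m. card (conj_embs G U) * card (cent G U) = card (carrier G) * m \<and>
      (\<forall>p. Factorial_Ring.prime p \<longrightarrow> p dvd m \<longrightarrow> \<not> of_nat p dvd (1::'r))"
  shows "e = (\<lambda>_. 0) \<or> e = bs_one G"
proof -
  have eR: "e \<in> RB_left_free G" using e by (simp add: central_idempotent_def)
  interpret E: central_ghost G "marks G e" using e by (rule central_ghost_marks)
  interpret F: central_ghost G "\<lambda>K. marks G (bs_one G) K - marks G e K"
    using E.central_ghost_axioms by (rule central_ghost_complement)
  define Z where "Z U \<longleftrightarrow> (\<forall>\<alpha>\<in>homs G U. marks G e (pair_graph U \<alpha> (incl U)) = 0)" for U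
  define Z' where "Z' U \<longleftrightarrow> (\<forall>\<alpha>\<in>homs G U. marks G (bs_one G) (pair_graph U \<alpha> (incl U)) - marks G e (pair_graph U \<alpha> (incl U)) = 0)" for U
  have dich: "Z U \<or> Z' U" if U: "subgroup U G" for U
    using central_ghost_dichotomy[OF e U] m[OF U] unfolding Z_def Z'_def by metis
  \<comment> \<open>Ensures that E and its complement are not both zero at the trivial
    group.\<close>
  have one: "marks G (bs_one G) {(\<one>, \<one>)} \<noteq> (0::'r)"
  proof -
    have t: "subgroup {\<one>} G" by (rule triv_subgroup)
    have "pair_graph {\<one>} (incl {\<one>}) (incl {\<one>}) = {(\<one>, \<one>)}" by (auto simp: pair_graph_incl)
    moreover have "marks G (bs_one G) (pair_graph {\<one>} (incl {\<one>}) (incl {\<one>})) = (of_nat (card (cent G {\<one>})) :: 'r)"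
      by (rule marks_one_incl[OF t])
    ultimately have "marks G (bs_one G) {(\<one>, \<one>)} = (of_nat (card (cent G {\<one>})) :: 'r)" by simp
    moreover have "card (cent G {\<one>}) \<noteq> 0"
      using subgroup.one_closed[OF subgroup_cent[OF t]]
        finite_subset[OF subgroup.subset[OF subgroup_cent[OF t]] fin] by auto
    ultimately show ?thesis by simp
  qed
  show ?thesis
  proof (cases "marks G e {(\<one>, \<one>)} = 0")
    case True
    then have "marks G (bs_one G) {(\<one>, \<one>)} - marks G e {(\<one>, \<one>)} \<noteq> 0" using one by simp
    then have "\<not> Z' U" if "subgroup U G" for U
      using F.zero_at_one[OF that] unfolding Z'_def by blast
    then have "Z U" if "subgroup U G" for U using dich that by blast
    then have "e = (\<lambda>_. 0)"
      using left_free_obtain unfolding Z_def by (intro marks_eq_zero[OF eR]) metis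
    then show ?thesis ..
  next
    case False
    then have "\<not> Z U" if "subgroup U G" for U
      using E.zero_at_one[OF that] unfolding Z_def by blast
    then have Z': "Z' U" if "subgroup U G" for U using dich that by blast
    have "(\<lambda>C. bs_one G C - e C) = (\<lambda>_. 0)"
    proof (rule marks_eq_zero)
      show "(\<lambda>C. bs_one G C - e C) \<in> RB_left_free G"
      proof -
        have "bs_one G \<in> (RB_left_free G :: (_ \<Rightarrow> 'r) set)" by (rule bs_one_RB)
        then have "C \<in> sub_classes G \<and> left_free G (rep C)" if "bs_one G C \<noteq> e C" for C
          using that eR unfolding RB_left_free_def mem_Collect_eq by metis
        then show ?thesis unfolding RB_left_free_def by auto
      qed
      fix K assume K: "subgroup K (G \<times>\<times> G)" "left_free G K"
      have "marks G (\<lambda>C. bs_one G C - e C) K = marks G (bs_one G) K - marks G e K"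
        by (simp add: marks_def left_diff_distrib sum_subtractf)
      also have "\<dots> = 0" using left_free_obtain[OF K] Z' unfolding Z'_def by metis
      finally show "marks G (\<lambda>C. bs_one G C - e C) K = 0" .
    qed
    then have "e = bs_one G" by (auto simp: fun_eq_iff)
    then show ?thesis ..
  qed
qed

end

section \<open>Automorphisms, normalizers and the order of Out(U)\<close>

context fin_group
begin

definition normalizing :: "'g set \<Rightarrow> 'g set" where
  "normalizing U = {g \<in> carrier G. conj_sub G g U = U}"

definition aut_maps :: "'g set \<Rightarrow> ('g \<Rightarrow> 'g) set" where
  "aut_maps U = {\<phi> \<in> homs G U. \<phi> ` U = U}"

lemma subgroup_normalizing:
  assumes U: "subgroup U G"
  shows "subgroup (normalizing U) G"
proof (rule subgroupI)
  note s = subgroup.subset[OF U]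
  show "normalizing U \<noteq> {}" using conj_sub_one[OF s] one_closed by (auto simp: normalizing_def)
  fix a assume a: "a \<in> normalizing U"
  then show "inv a \<in> normalizing U" using conj_sub_inv(1)[of a U] s by (auto simp: normalizing_def)
  fix b assume "b \<in> normalizing U"
  with a show "a \<otimes> b \<in> normalizing U" using conj_sub_mult[of a b U] s by (auto simp: normalizing_def)
qed (auto simp: normalizing_def)

lemma subgroup_subset_normalizing:
  assumes U: "subgroup U G"
  shows "U \<subseteq> normalizing U"
proof
  fix g assume g: "g \<in> U"
  note gc = subgroup.mem_carrier[OF U g]
  have sub: "conj_sub G h U \<subseteq> U" if "h \<in> U" for h
    using that subgroup.m_closed[OF U] subgroup.m_inv_closed[OF U] by (auto simp: conj_sub_def)
  have "conj_sub G g (conj_sub G (inv g) U) \<subseteq> conj_sub G g U"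
    using sub[OF subgroup.m_inv_closed[OF U g]] by (auto simp: conj_sub_def)
  then have "U \<subseteq> conj_sub G g U" using conj_sub_inv(2)[OF gc subgroup.subset[OF U]] by simp
  then show "g \<in> normalizing U" using sub[OF g] gc by (auto simp: normalizing_def)
qed

lemma cent_subset_normalizing:
  assumes "subgroup U G"
  shows "cent G U \<subseteq> normalizing U"
proof
  fix g assume g: "g \<in> cent G U"
  have "g \<otimes> u \<otimes> inv g = u" if "u \<in> U" for u
    using g that subgroup.mem_carrier[OF assms that] by (simp add: cent_def m_assoc)
  then have "conj_sub G g U = U" by (simp add: conj_sub_def)
  then show "g \<in> normalizing U" using g by (simp add: normalizing_def cent_def)
qed

lemma conjh_image:
  assumes "g \<in> carrier G"
  shows "conjh G U g \<alpha> ` U = conj_sub G g (\<alpha> ` U)"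
  by (auto simp: conjh_def conj_sub_def)

text \<open>Since \<phi> maps U onto U, fixing \<phi> means centralizing all of U; the stabilizer
  thus does not depend on \<phi>.\<close>

lemma conjh_fix_iff:
  assumes U: "subgroup U G" and \<phi>: "\<phi> \<in> aut_maps U" and g: "g \<in> carrier G"
  shows "conjh G U g \<phi> = \<phi> \<longleftrightarrow> g \<in> cent G U"
proof -
  have \<phi>h: "\<phi> \<in> homs G U" and im: "\<phi> ` U = U" using \<phi> by (auto simp: aut_maps_def)
  have "conjh G U g \<phi> = \<phi> \<longleftrightarrow> (\<forall>u\<in>U. conjh G U g \<phi> u = \<phi> u)"
    using homs_ext[OF conjh_homs[OF U \<phi>h g] \<phi>h] by auto
  also have "\<dots> \<longleftrightarrow> (\<forall>u\<in>U. g \<otimes> \<phi> u \<otimes> inv g = \<phi> u)" by (simp add: conjh_def)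
  also have "\<dots> \<longleftrightarrow> (\<forall>v\<in>\<phi> ` U. g \<otimes> v \<otimes> inv g = v)" by simp
  also have "\<dots> \<longleftrightarrow> (\<forall>v\<in>U. v \<otimes> g = g \<otimes> v)"
    unfolding im using g inv_solve_right'[of "_" "_" g] subgroup.mem_carrier[OF U]
    by (intro ball_cong refl) auto
  finally show ?thesis using g by (auto simp: cent_def)
qed

lemma incl_aut_maps: "subgroup U G \<Longrightarrow> incl U \<in> aut_maps U"
  using incl_homs by (auto simp: aut_maps_def incl_def)

lemma aut_maps_conj_embs: "subgroup U G \<Longrightarrow> aut_maps U \<subseteq> conj_embs G U"
  using conj_sub_one[OF subgroup.subset] one_closed unfolding aut_maps_def conj_embs_def by force

lemma finite_aut_maps: "subgroup U G \<Longrightarrow> finite (aut_maps U)"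
  using finite_homs finite_subset[of "aut_maps U"] by (auto simp: aut_maps_def)

lemma gset_conjh:
  assumes U: "subgroup U G" and H: "subgroup H G"
    and A: "A \<subseteq> homs G U" "\<And>h \<alpha>. h \<in> H \<Longrightarrow> \<alpha> \<in> A \<Longrightarrow> conjh G U h \<alpha> \<in> A"
  shows "gset (G\<lparr>carrier := H\<rparr>) A (conjh G U)"
proof (rule gset.intro)
  show "group (G\<lparr>carrier := H\<rparr>)" using subgroup.subgroup_is_group[OF H is_group] .
  show "gset_axioms (G\<lparr>carrier := H\<rparr>) A (conjh G U)"
    by unfold_locales (use A conjh_one conjh_conjh subgroup.mem_carrier[OF H] in auto)
qed

lemma auto_eq_aut_maps:
  assumes U: "subgroup U G"
  shows "auto (G\<lparr>carrier := U\<rparr>) = aut_maps U"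
proof (intro equalityI subsetI)
  fix \<phi> assume \<phi>: "\<phi> \<in> auto (G\<lparr>carrier := U\<rparr>)"
  then have "\<phi> \<in> extensional U" "\<phi> ` U = U"
    "\<And>u v. u \<in> U \<Longrightarrow> v \<in> U \<Longrightarrow> \<phi> (u \<otimes> v) = \<phi> u \<otimes> \<phi> v"
    by (auto simp: auto_def hom_def Bij_def bij_betw_def)
  then show "\<phi> \<in> aut_maps U"
    using subgroup.subset[OF U] by (auto simp: aut_maps_def homs_def PiE_def)
next
  fix \<phi> assume \<phi>: "\<phi> \<in> aut_maps U"
  have "inj_on \<phi> U" using conj_embs_inj[OF U] \<phi> aut_maps_conj_embs[OF U] by blast
  with \<phi> show "\<phi> \<in> auto (G\<lparr>carrier := U\<rparr>)"
    by (auto simp: aut_maps_def homs_def auto_def hom_def Bij_def bij_betw_def PiE_def)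
qed

lemma inn_eq:
  assumes U: "subgroup U G"
  shows "inn (G\<lparr>carrier := U\<rparr>) = (\<lambda>g. conjh G U g (incl U)) ` U"
proof -
  have "restrict (\<lambda>x. g \<otimes> x \<otimes> inv\<^bsub>G\<lparr>carrier := U\<rparr>\<^esub> g) U = conjh G U g (incl U)" if "g \<in> U" for g
    using m_inv_consistent[OF U that] by (auto simp: conjh_def incl_def restrict_def fun_eq_iff)
  then have "(\<lambda>g. restrict (\<lambda>x. g \<otimes> x \<otimes> inv\<^bsub>G\<lparr>carrier := U\<rparr>\<^esub> g) U) ` U = (\<lambda>g. conjh G U g (incl U)) ` U"
    by (rule image_cong[OF refl])
  then show ?thesis by (simp add: inn_def Setcompr_eq_image)
qed

text \<open>The map (g, \<phi>) -> g \<phi> g^-1 sends G \<times> Aut(U) onto the conjugates of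
  automorphisms, and all its fibres have the size of the normalizer.\<close>

lemma card_aut_mult_card:
  assumes U: "subgroup U G"
  shows "card (carrier G) * card (aut_maps U) = card (normalizing U) * card (conj_embs G U)"
proof -
  note s = subgroup.subset[OF U]
  let ?f = "\<lambda>(g, \<phi>). conjh G U g \<phi>"
  have "card (carrier G \<times> aut_maps U) = card (normalizing U) * card (conj_embs G U)"
  proof (rule card_fibres[of _ ?f])
    show "finite (carrier G \<times> aut_maps U)" using fin finite_aut_maps[OF U] by simp
    show "?f ` (carrier G \<times> aut_maps U) = conj_embs G U"
    proof (intro equalityI subsetI)
      fix \<alpha> assume "\<alpha> \<in> ?f ` (carrier G \<times> aut_maps U)"
      then show "\<alpha> \<in> conj_embs G U" using conj_embs_conjh[OF U] aut_maps_conj_embs[OF U] by auto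
    next
      fix \<alpha> assume \<alpha>: "\<alpha> \<in> conj_embs G U"
      then obtain g where g: "g \<in> carrier G" "\<alpha> ` U = conj_sub G g U" and \<alpha>h: "\<alpha> \<in> homs G U"
        by (auto simp: conj_embs_def)
      have "conjh G U (inv g) \<alpha> \<in> aut_maps U"
        using conjh_homs[OF U \<alpha>h] conjh_image[of "inv g" U \<alpha>] conj_sub_inv(1)[OF g(1) s] g
        by (simp add: aut_maps_def)
      moreover have "\<alpha> = conjh G U g (conjh G U (inv g) \<alpha>)"
        using g \<alpha>h by (simp add: conjh_conjh conjh_one)
      ultimately show "\<alpha> \<in> ?f ` (carrier G \<times> aut_maps U)" using g(1) by force
    qed
    fix \<alpha> assume "\<alpha> \<in> conj_embs G U"
    then obtain g where g: "g \<in> carrier G" "\<alpha> ` U = conj_sub G g U" and \<alpha>h: "\<alpha> \<in> homs G U"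
      by (auto simp: conj_embs_def)
    \<comment> \<open>If \<alpha> maps U onto g U g^-1, the admissible first components form the
      coset g N(U), and each determines its automorphism.\<close>
    have fib: "{w \<in> carrier G \<times> aut_maps U. ?f w = \<alpha>} =
        (\<lambda>n. (g \<otimes> n, conjh G U (inv (g \<otimes> n)) \<alpha>)) ` normalizing U" (is "?F = ?I")
    proof (intro equalityI subsetI)
      fix w assume "w \<in> ?F"
      then obtain h \<phi> where w: "w = (h, \<phi>)" "h \<in> carrier G" "\<phi> \<in> aut_maps U" "conjh G U h \<phi> = \<alpha>" by auto
      have \<phi>h: "\<phi> \<in> homs G U" "\<phi> ` U = U" using w by (auto simp: aut_maps_def)
      have "conj_sub G h U = conj_sub G g U" using w(2,4) \<phi>h conjh_image[of h U \<phi>] g(2) by simp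
      then have "conj_sub G (inv g \<otimes> h) U = U"
        using g(1) w(2) s by (simp add: conj_sub_mult conj_sub_inv)
      then have "inv g \<otimes> h \<in> normalizing U" using g(1) w(2) by (simp add: normalizing_def)
      moreover have "g \<otimes> (inv g \<otimes> h) = h" using g(1) w(2) by (simp add: m_assoc[symmetric])
      moreover have "conjh G U (inv h) \<alpha> = \<phi>"
        using w \<phi>h by (auto simp: conjh_conjh conjh_one)
      ultimately show "w \<in> ?I" using w(1) by (intro image_eqI[of _ _ "inv g \<otimes> h"]) simp_all
    next
      fix w assume "w \<in> ?I"
      then obtain n where n: "n \<in> normalizing U" "w = (g \<otimes> n, conjh G U (inv (g \<otimes> n)) \<alpha>)" by blast
      have nc: "n \<in> carrier G" "conj_sub G n U = U" using n by (auto simp: normalizing_def)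
      have "\<alpha> ` U = conj_sub G (g \<otimes> n) U" using g nc s by (simp add: conj_sub_mult)
      then have "conjh G U (inv (g \<otimes> n)) \<alpha> \<in> aut_maps U"
        using conjh_homs[OF U \<alpha>h] conjh_image[of "inv (g \<otimes> n)" U \<alpha>] conj_sub_inv(1)[of "g \<otimes> n" U] g nc s
        by (simp add: aut_maps_def)
      moreover have "conjh G U (g \<otimes> n) (conjh G U (inv (g \<otimes> n)) \<alpha>) = \<alpha>"
        using g(1) nc(1) \<alpha>h conjh_conjh[OF \<alpha>h, of "g \<otimes> n" "inv (g \<otimes> n)"] by (simp add: conjh_one)
      ultimately show "w \<in> ?F" using n(2) g(1) nc(1) by simp
    qed
    have "inj_on (\<lambda>n. (g \<otimes> n, conjh G U (inv (g \<otimes> n)) \<alpha>)) (normalizing U)"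
      using g(1) by (auto simp: inj_on_def normalizing_def)
    then show "card {w \<in> carrier G \<times> aut_maps U. ?f w = \<alpha>} = card (normalizing U)"
      unfolding fib by (rule card_image)
  qed
  then show ?thesis by (simp add: card_cartesian_product)
qed

text \<open>The witness is j = |Aut(U)| |C(U)| / |N(U)|, an integer because N(U) acts on Aut(U) with
  all stabilizers equal to C(U). Let A be the image of N(U) in Aut(U) and I = Inn(U). Then |A| = |I|
  k and |Aut(U)| = |I| k j, so j divides |Out(U)| = k j, where k is the index of U C(U) in
  N(U).\<close>

lemma card_conj_embs_cent:
  assumes U: "subgroup U G"
  obtains m where "card (conj_embs G U) * card (cent G U) = card (carrier G) * m"
    and "m dvd out_order (G\<lparr>carrier := U\<rparr>)"
proof -
  define N where "N = normalizing U"
  define C where "C = cent G U"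
  define A where "A = (\<lambda>g. conjh G U g (incl U)) ` N"
  define I where "I = (\<lambda>g. conjh G U g (incl U)) ` U"
  have sN: "subgroup N G" unfolding N_def using subgroup_normalizing[OF U] .
  have finN: "finite N" using finite_subset[OF subgroup.subset[OF sN] fin] .
  have finU: "finite U" using finite_subset[OF subgroup.subset[OF U] fin] .
  note i = incl_homs[OF U] and ia = incl_aut_maps[OF U]
  have CN: "C \<subseteq> N" and UN: "U \<subseteq> N"
    unfolding C_def N_def using cent_subset_normalizing[OF U] subgroup_subset_normalizing[OF U] .
  have Nc: "n \<in> carrier G" if "n \<in> N" for n using that by (simp add: N_def normalizing_def)
  have N_aut: "conjh G U n \<phi> \<in> aut_maps U" if "n \<in> N" "\<phi> \<in> aut_maps U" for n \<phi>
    using that conjh_homs[OF U] conjh_image by (auto simp: N_def normalizing_def aut_maps_def)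
  have A_aut: "A \<subseteq> aut_maps U" unfolding A_def using N_aut ia by blast
  have finA: "finite A" using finN by (simp add: A_def)
  have pos: "card N \<noteq> 0" "card C \<noteq> 0" "card (carrier G) \<noteq> 0" "card I \<noteq> 0" "card (C \<inter> U) \<noteq> 0"
    using finN fin finU subgroup.one_closed[OF sN] subgroup.one_closed[OF U] finite_subset[OF CN finN]
      subgroup.one_closed[OF subgroup_cent[OF U]] by (auto simp: I_def C_def card_eq_0_iff)
  interpret N: gset "G\<lparr>carrier := N\<rparr>" "aut_maps U" "conjh G U"
    using N_aut by (intro gset_conjh[OF U sN]) (auto simp: aut_maps_def)
  have stabN: "N.stab \<phi> = C" if "\<phi> \<in> aut_maps U" for \<phi>
    using conjh_fix_iff[OF U that] CN Nc unfolding N.stab_def by (auto simp: C_def)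
  have "card N dvd card (aut_maps U) * card C"
    using N.card_dvd_of_stab[of "card C"] finN finite_aut_maps[OF U] stabN by simp
  then obtain j where j: "card (aut_maps U) * card C = card N * j" by (auto elim: dvdE)
  have "N.orb (incl U) = A" by (simp add: N.orb_def A_def)
  then have NA: "card N = card C * card A"
    using N.card_orb_stab[OF _ ia] finN stabN[OF ia] by simp
  have UA: "conjh G U u \<phi> \<in> A" if u: "u \<in> U" and \<phi>: "\<phi> \<in> A" for u \<phi>
  proof -
    obtain n where n: "n \<in> N" "\<phi> = conjh G U n (incl U)" using \<phi> by (auto simp: A_def)
    then have "conjh G U u \<phi> = conjh G U (u \<otimes> n) (incl U)"
      using u UN Nc conjh_conjh[OF i] by blast
    moreover have "u \<otimes> n \<in> N" using subgroup.m_closed[OF sN] u n UN by blast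
    ultimately show ?thesis by (simp add: A_def)
  qed
  \<comment> \<open>This action, with stabilizers C(U) \<inter> U, replaces Lagrange for Inn(U)
    inside A: every orbit has |Inn(U)| elements, so |Inn(U)| divides |A|.\<close>
  interpret V: gset "G\<lparr>carrier := U\<rparr>" A "conjh G U"
    using UA A_aut by (intro gset_conjh[OF U U]) (auto simp: aut_maps_def)
  have stabV: "V.stab \<phi> = C \<inter> U" if "\<phi> \<in> A" for \<phi>
    using conjh_fix_iff[OF U, of \<phi>] that A_aut UN Nc unfolding V.stab_def by (auto simp: C_def)
  have iA: "incl U \<in> A"
    using conjh_one[OF i] subgroup.one_closed[OF sN] unfolding A_def by (metis image_eqI)
  have "card U dvd card A * card (C \<inter> U)"
    using V.card_dvd_of_stab[of "card (C \<inter> U)"] finU finA stabV by simp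
  then obtain k where k: "card A * card (C \<inter> U) = card U * k" by (auto elim: dvdE)
  have "V.orb (incl U) = I" by (simp add: V.orb_def I_def)
  then have "card U = card (C \<inter> U) * card I"
    using V.card_orb_stab[OF _ iA] finU stabV[OF iA] by simp
  with k have "card (C \<inter> U) * card A = card (C \<inter> U) * (card I * k)" by (simp add: mult_ac)
  then have AI: "card A = card I * k" using pos by simp
  from j NA have "card C * card (aut_maps U) = card C * (card A * j)" by (simp add: mult_ac)
  then have Aut: "card (aut_maps U) = card I * k * j" using pos AI by simp
  have "out_order (G\<lparr>carrier := U\<rparr>) = k * j"
    unfolding out_order_def auto_eq_aut_maps[OF U] inn_eq[OF U] I_def[symmetric] Aut
    using pos by (simp add: mult.assoc)
  then have "j dvd out_order (G\<lparr>carrier := U\<rparr>)" by simp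
  moreover have "card N * (card (conj_embs G U) * card C) = card N * (card (carrier G) * j)"
    using card_aut_mult_card[OF U] j unfolding N_def[symmetric] by (metis mult.assoc mult.left_commute)
  then have "card (conj_embs G U) * card C = card (carrier G) * j" using pos by simp
  ultimately show thesis using that unfolding C_def by blast
qed

end

section \<open>Conclusion over R and over the integers\<close>

lemma central_idempotent_cases:
  fixes G :: "('g, 'b) monoid_scheme" and e :: "('g \<times> 'g) set set \<Rightarrow> 'r::{idom, ring_char_0}"
  assumes "group G" "finite (carrier G)"
    and p: "\<And>U p. subgroup U G \<Longrightarrow> Factorial_Ring.prime (p::nat) \<Longrightarrow> p dvd out_order (G\<lparr>carrier := U\<rparr>)
      \<Longrightarrow> \<not> of_nat p dvd (1::'r)"
    and e: "central_idempotent G e"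
  shows "e = (\<lambda>_. 0) \<or> e = bs_one G"
proof -
  interpret fin_group G using assms(1,2) by (intro fin_group.intro fin_group_axioms.intro)
  show ?thesis
  proof (rule central_idempotent_trivial[OF e])
    fix U assume U: "subgroup U G"
    obtain m where "card (conj_embs G U) * card (cent G U) = card (carrier G) * m"
      "m dvd out_order (G\<lparr>carrier := U\<rparr>)"
      using card_conj_embs_cent[OF U] .
    then show "\<exists>m. card (conj_embs G U) * card (cent G U) = card (carrier G) * m \<and>
        (\<forall>p. Factorial_Ring.prime p \<longrightarrow> p dvd m \<longrightarrow> \<not> of_nat p dvd (1::'r))"
      using p[OF U] dvd_trans by blast
  qed
qed

text \<open>The condition that pR differs from R is expressed by p not dividing 1, and
  \<open>ring_char_0\<close> on a domain expresses that its field of fractions has characteristic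
  0.\<close>

theorem theorem5p11:
  fixes G :: "('g, 'b) monoid_scheme"
  assumes "group G" and "finite (carrier G)"
    and hR: "\<And>U p. subgroup U G \<Longrightarrow> Factorial_Ring.prime (p::nat) \<Longrightarrow> p dvd out_order (G\<lparr>carrier := U\<rparr>)
               \<Longrightarrow> \<not> (of_nat p dvd (1::'r::{idom, ring_char_0}))"
  shows "(\<forall>e :: ('g \<times> 'g) set set \<Rightarrow> 'r. central_idempotent G e \<longrightarrow> e = (\<lambda>_. 0) \<or> e = bs_one G)
       \<and> (\<forall>e :: ('g \<times> 'g) set set \<Rightarrow> int. central_idempotent G e \<longrightarrow> e = (\<lambda>_. 0) \<or> e = bs_one G)"
proof (intro conjI allI impI)
  fix e :: "('g \<times> 'g) set set \<Rightarrow> 'r" assume e: "central_idempotent G e"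
  show "e = (\<lambda>_. 0) \<or> e = bs_one G"
    using assms(1,2) hR e by (rule central_idempotent_cases)
next
  fix e :: "('g \<times> 'g) set set \<Rightarrow> int" assume e: "central_idempotent G e"
  \<comment> \<open>The integers meet the hypothesis for every finite group, since no prime is a
    unit there.\<close>
  have "\<not> of_nat p dvd (1::int)" if "Factorial_Ring.prime p" for p :: nat
    using that prime_gt_1_nat by fastforce
  with assms(1,2) show "e = (\<lambda>_. 0) \<or> e = bs_one G" using e by (intro central_idempotent_cases) auto
qed

end
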